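(* Let $m\ge 2$, let $\vec a=(a_0,a_1,\dots,a_{m-1})\in\mathbb{C}^m$ and let $P_m(y)=y^m+a_{m-1}y^{m-1}+\dots+a_1y+a_0$. If the Critical Values Discriminant of $P_m$ satisfies $\mathrm{CVD}(\vec a)\neq 0$, then: (i) all the critical points of $P_m$ are non-degenerate and its critical values (the values of $P_m$ at its critical points) are pairwise different; (ii) $\mathrm{Mon}(\vec a)=\mathrm{S}(m)$, i.e. the monodromy group of the Riemann surface of the multivalued function $P_m^{-1}$ is the full symmetric group on the $m$ sheets.
   Context: The companion matrix of a monic polynomial $Q(y)=y^n+c_{n-1}y^{n-1}+\dots+c_0$ is the $n\times n$ matrix with $1$'s on the subdiagonal, last column $(-c_0,-c_1,\dots,-c_{n-1})^T$, and zeros elsewhere; its characteristic polynomial is $Q$ up to sign. Critical Values Discriminant: let $\tilde P_m'(y)=\frac1m P_m'(y)=y^{m-1}+\frac{m-1}{m}a_{m-1}y^{m-2}+\dots+\frac{a_1}{m}$, let $C(\vec a)$ be the $(m-1)\times(m-1)$ companion matrix of $\tilde P_m'$, let $P_m(C(\vec a))=C(\vec a)^m+a_{m-1}C(\vec a)^{m-1}+\dots+a_1C(\vec a)+a_0I$, and let $U_{m-1}^{\vec a}(y)=\det(P_m(C(\vec a))-yI)$. Then $\mathrm{CVD}(\vec a)$ is the discriminant of the polynomial $U_{m-1}^{\vec a}$ (the discriminant of a polynomial of degree $1$ is a nonzero constant). A critical point $y_0$ of $P_m$ (a zero of $P_m'$) is non-degenerate if $P_m''(y_0)\ne 0$. $\mathrm{Mon}(\vec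 a)$ is the monodromy group of the Riemann surface of $P_m^{-1}$: with $B$ the finite set of critical values of $P_m$ and $x_0\in\mathbb{C}\setminus B$, it is the group of permutations of the $m$-element fibre $P_m^{-1}(x_0)$ induced by lifting loops in $\mathbb{C}\setminus B$ based at $x_0$ through the covering $P_m:\mathbb{C}\setminus P_m^{-1}(B)\to\mathbb{C}\setminus B$. $\mathrm{S}(m)$ is the symmetric group of $m$ elements. *)

theory Defs
  imports
    "HOL-Analysis.Analysis"
    "HOL-Algebra.Bij"
    "Jordan_Normal_Form.Char_Poly"
    "Subresultants.Resultant_Prelim"
begin

subsection \<open>The Critical Values Discriminant\<close>

text \<open>Meant for monic \<open>Q\<close> of positive degree \<open>n\<close>; rows and columns are numbered from \<open>0\<close>.\<close>

definition companion_mat :: "'a::comm_ring_1 poly \<Rightarrow> 'a mat" where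
  "companion_mat Q = (let n = degree Q in
     mat n n (\<lambda>(i, j). if j = n - 1 then - coeff Q i else if i = j + 1 then 1 else 0))"

text \<open>The matrix \<open>\<Sum>k. p\<^sub>k A\<^sup>k\<close> (with \<open>A\<^sup>0 = I\<close>) for a square matrix \<open>A\<close>. The sum is taken entry
  by entry because matrices of unspecified size do not form a \<open>comm_monoid_add\<close>.\<close>

definition poly_mat :: "'a::comm_ring_1 poly \<Rightarrow> 'a mat \<Rightarrow> 'a mat" where
  "poly_mat p A = mat (dim_row A) (dim_row A)
     (\<lambda>(i, j). \<Sum>k\<le>degree p. coeff p k * (A ^\<^sub>m k) $$ (i, j))"

text \<open>\<open>(-1)\<^bsup>n(n-1)/2\<^esup> Res(f, f') / lc(f)\<close> for \<open>f\<close> of degree \<open>n > 0\<close>. Characteristic \<open>0\<close> ensures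
  \<open>degree f' = n - 1\<close>, so \<^const>\<open>resultant\<close> uses the Sylvester matrix of the right size. For \<open>n = 1\<close>
  the value is \<open>1\<close>.\<close>

definition discriminant :: "'a::field_char_0 poly \<Rightarrow> 'a" where
  "discriminant f = (-1) ^ (degree f * (degree f - 1) div 2)
     * resultant f (pderiv f) / lead_coeff f"

text \<open>Only \<open>a 0, \<dots>, a (m - 1)\<close> matter: \<open>a\<close> represents a vector in \<open>\<complex>\<^sup>m\<close>.\<close>

definition monic_poly :: "nat \<Rightarrow> (nat \<Rightarrow> complex) \<Rightarrow> complex poly" where
  "monic_poly m a = monom 1 m + (\<Sum>i<m. monom (a i) i)"

definition CVD_mat :: "nat \<Rightarrow> (nat \<Rightarrow> complex) \<Rightarrow> complex mat" where
  "CVD_mat m a =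
     poly_mat (monic_poly m a) (companion_mat (Polynomial.smult (1 / of_nat m) (pderiv (monic_poly m a))))"

text \<open>The determinant is computed over \<open>\<complex>[y]\<close>; \<open>[:0, 1:]\<close> is the indeterminate \<open>y\<close>. This differs
  from \<^const>\<open>char_poly\<close> by the sign \<open>(-1)\<^bsup>m-1\<^esup>\<close>.\<close>

definition CVD_poly :: "nat \<Rightarrow> (nat \<Rightarrow> complex) \<Rightarrow> complex poly" where
  "CVD_poly m a =
     det (map_mat (\<lambda>c. [:c:]) (CVD_mat m a) - [:0, 1:] \<cdot>\<^sub>m 1\<^sub>m (m - 1))"

definition CVD :: "nat \<Rightarrow> (nat \<Rightarrow> complex) \<Rightarrow> complex" where
  "CVD m a = discriminant (CVD_poly m a)"

subsection \<open>Critical points and monodromy\<close>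

definition critical_points :: "complex poly \<Rightarrow> complex set" where
  "critical_points p = {y. poly (pderiv p) y = 0}"

definition nondegenerate :: "complex poly \<Rightarrow> complex \<Rightarrow> bool" where
  "nondegenerate p y \<longleftrightarrow> poly (pderiv (pderiv p)) y \<noteq> 0"

definition critical_values :: "complex poly \<Rightarrow> complex set" where
  "critical_values p = poly p ` critical_points p"

definition fibre :: "complex poly \<Rightarrow> complex \<Rightarrow> complex set" where
  "fibre p x = {y. poly p y = x}"

definition is_lift :: "complex poly \<Rightarrow> (real \<Rightarrow> complex) \<Rightarrow> (real \<Rightarrow> complex) \<Rightarrow> bool" where
  "is_lift p \<gamma> g \<longleftrightarrow> path g \<and> path_image g \<subseteq> - (poly p -` critical_values p) \<and>
     (\<forall>t\<in>{0..1}. poly p (g t) = \<gamma> t)"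

definition base_loop :: "complex poly \<Rightarrow> complex \<Rightarrow> (real \<Rightarrow> complex) \<Rightarrow> bool" where
  "base_loop p x0 \<gamma> \<longleftrightarrow> path \<gamma> \<and> path_image \<gamma> \<subseteq> - critical_values p \<and>
     pathstart \<gamma> = x0 \<and> pathfinish \<gamma> = x0"

definition induced_by :: "complex poly \<Rightarrow> complex \<Rightarrow> (real \<Rightarrow> complex) \<Rightarrow> (complex \<Rightarrow> complex) \<Rightarrow> bool"
  where
  "induced_by p x0 \<gamma> \<sigma> \<longleftrightarrow>
     (\<forall>y\<in>fibre p x0. \<exists>g. is_lift p \<gamma> g \<and> pathstart g = y \<and> pathfinish g = \<sigma> y)"

text \<open>\<^const>\<open>BijGroup\<close> is the symmetric group on a set. For \<open>x0\<close> outside the critical values, lifts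
  exist and are unique, so each loop induces exactly one element of \<^term>\<open>Bij (fibre p x0)\<close>.\<close>

definition monodromy_group :: "complex poly \<Rightarrow> complex \<Rightarrow> (complex \<Rightarrow> complex) monoid" where
  "monodromy_group p x0 = (BijGroup (fibre p x0))
     \<lparr>carrier := {\<sigma> \<in> Bij (fibre p x0). \<exists>\<gamma>. base_loop p x0 \<gamma> \<and> induced_by p x0 \<gamma> \<sigma>}\<rparr>"

lemma carrier_monodromy_group:
  "carrier (monodromy_group p x0) =
     {\<sigma> \<in> Bij (fibre p x0). \<exists>\<gamma>. base_loop p x0 \<gamma> \<and> induced_by p x0 \<gamma> \<sigma>}"
  by (simp add: monodromy_group_def)

lemma lift_join:
  assumes "is_lift p \<gamma> g" "is_lift p \<delta> h" "pathfinish g = pathstart h"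
  shows "is_lift p (\<gamma> +++ \<delta>) (g +++ h)"
proof -
  have "poly p ((g +++ h) t) = (\<gamma> +++ \<delta>) t" if "t \<in> {0..1}" for t
  proof (cases "t \<le> 1/2")
    case True
    then have "2 * t \<in> {0..1}" using that by simp
    then have "poly p (g (2 * t)) = \<gamma> (2 * t)" using assms(1) unfolding is_lift_def by blast
    with True show ?thesis by (simp add: joinpaths_def)
  next
    case False
    then have "2 * t - 1 \<in> {0..1}" using that by simp
    then have "poly p (h (2 * t - 1)) = \<delta> (2 * t - 1)" using assms(2) unfolding is_lift_def by blast
    with False show ?thesis by (simp add: joinpaths_def)
  qed
  moreover have "path (g +++ h)" using assms unfolding is_lift_def by simp
  moreover have "path_image (g +++ h) = path_image g \<union> path_image h"
    using assms(3) by (rule path_image_join)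
  ultimately show ?thesis using assms(1,2) unfolding is_lift_def by blast
qed

lemma lift_reverse:
  assumes "is_lift p \<gamma> g"
  shows "is_lift p (reversepath \<gamma>) (reversepath g)"
proof -
  have "poly p (reversepath g t) = reversepath \<gamma> t" if "t \<in> {0..1}" for t
  proof -
    have "1 - t \<in> {0..1}" using that by simp
    then have "poly p (g (1 - t)) = \<gamma> (1 - t)" using assms unfolding is_lift_def by blast
    then show ?thesis by (simp add: reversepath_def)
  qed
  with assms show ?thesis unfolding is_lift_def by simp
qed

lemma subgroup_monodromy_group:
  assumes x0: "x0 \<notin> critical_values p"
  shows "subgroup (carrier (monodromy_group p x0)) (BijGroup (fibre p x0))"
proof -
  let ?F = "fibre p x0" and ?M = "carrier (monodromy_group p x0)"
  interpret group "BijGroup ?F" by (rule group_BijGroup)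
  have M: "\<sigma> \<in> ?M \<longleftrightarrow> \<sigma> \<in> Bij ?F \<and> (\<exists>\<gamma>. base_loop p x0 \<gamma> \<and> induced_by p x0 \<gamma> \<sigma>)" for \<sigma>
    by (auto simp: carrier_monodromy_group)
  have carr: "carrier (BijGroup ?F) = Bij ?F" by (simp add: BijGroup_def)
  show ?thesis
  proof (rule subgroupI)
    show "?M \<subseteq> carrier (BijGroup ?F)" using M carr by auto
  next
    have "base_loop p x0 (\<lambda>_. x0)"
      using x0 by (auto simp: base_loop_def path_def path_image_def pathstart_def pathfinish_def)
    moreover have "induced_by p x0 (\<lambda>_. x0) (\<lambda>x\<in>?F. x)"
      unfolding induced_by_def
    proof
      fix y assume y: "y \<in> ?F"
      show "\<exists>g. is_lift p (\<lambda>_. x0) g \<and> pathstart g = y \<and> pathfinish g = (\<lambda>x\<in>?F. x) y"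
        using y x0 by (intro exI[of _ "\<lambda>_. y"])
          (auto simp: is_lift_def fibre_def path_def path_image_def pathstart_def pathfinish_def)
    qed
    ultimately show "?M \<noteq> {}" unfolding ex_in_conv[symmetric] M using id_Bij[of ?F] by blast
  next
    fix \<sigma> assume s: "\<sigma> \<in> ?M"
    then obtain \<gamma> where sB: "\<sigma> \<in> Bij ?F" and g: "base_loop p x0 \<gamma>" "induced_by p x0 \<gamma> \<sigma>"
      using M by auto
    have bij: "bij_betw \<sigma> ?F ?F" using sB by (simp add: Bij_def)
    have inv: "inv\<^bsub>BijGroup ?F\<^esub> \<sigma> = (\<lambda>x\<in>?F. inv_into ?F \<sigma> x)"
      using sB by (intro inv_equality)
        (auto simp: BijGroup_def Bij_compose_restrict_eq restrict_inv_into_Bij)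
    have "induced_by p x0 (reversepath \<gamma>) (\<lambda>x\<in>?F. inv_into ?F \<sigma> x)"
      unfolding induced_by_def
    proof
      fix y assume y: "y \<in> ?F"
      let ?z = "inv_into ?F \<sigma> y"
      have z: "?z \<in> ?F" "\<sigma> ?z = y"
        using bij y by (metis bij_betw_def inv_into_into, metis bij_betw_inv_into_right)
      then obtain l where "is_lift p \<gamma> l" "pathstart l = ?z" "pathfinish l = y"
        using g(2)[unfolded induced_by_def, rule_format, of ?z] by auto
      then show "\<exists>l. is_lift p (reversepath \<gamma>) l \<and> pathstart l = y \<and>
          pathfinish l = (\<lambda>x\<in>?F. inv_into ?F \<sigma> x) y"
        using y by (intro exI[of _ "reversepath l"]) (simp add: lift_reverse)
    qed
    moreover have "base_loop p x0 (reversepath \<gamma>)"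
      using g(1) by (auto simp: base_loop_def)
    ultimately show "inv\<^bsub>BijGroup ?F\<^esub> \<sigma> \<in> ?M"
      unfolding M inv using restrict_inv_into_Bij[OF sB] by blast
  next
    fix \<sigma> \<tau> assume "\<sigma> \<in> ?M" "\<tau> \<in> ?M"
    then obtain \<gamma> \<delta> where B: "\<sigma> \<in> Bij ?F" "\<tau> \<in> Bij ?F"
      and g: "base_loop p x0 \<gamma>" "induced_by p x0 \<gamma> \<sigma>"
      and d: "base_loop p x0 \<delta>" "induced_by p x0 \<delta> \<tau>"
      using M by auto
    have "induced_by p x0 (\<delta> +++ \<gamma>) (compose ?F \<sigma> \<tau>)"
      unfolding induced_by_def
    proof
      fix y assume y: "y \<in> ?F"
      then have t: "\<tau> y \<in> ?F" using B(2) Bij_imp_funcset by fastforce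
      obtain k where k: "is_lift p \<delta> k" "pathstart k = y" "pathfinish k = \<tau> y"
        using d(2)[unfolded induced_by_def, rule_format, OF y] by blast
      obtain l where l: "is_lift p \<gamma> l" "pathstart l = \<tau> y" "pathfinish l = \<sigma> (\<tau> y)"
        using g(2)[unfolded induced_by_def, rule_format, OF t] by blast
      show "\<exists>h. is_lift p (\<delta> +++ \<gamma>) h \<and> pathstart h = y \<and> pathfinish h = compose ?F \<sigma> \<tau> y"
        using k l y by (intro exI[of _ "k +++ l"]) (simp add: compose_eq lift_join)
    qed
    moreover have "base_loop p x0 (\<delta> +++ \<gamma>)"
      using g(1) d(1) by (auto simp: base_loop_def path_image_join)
    moreover have comp: "\<sigma> \<otimes>\<^bsub>BijGroup ?F\<^esub> \<tau> = compose ?F \<sigma> \<tau>"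
      using B by (simp add: BijGroup_def)
    ultimately show "\<sigma> \<otimes>\<^bsub>BijGroup ?F\<^esub> \<tau> \<in> ?M"
      unfolding M comp using compose_Bij[OF B] by blast
  qed
qed

end

theory Submission
  imports
    Defs
    "HOL-Combinatorics.Permutations"
    "HOL-Complex_Analysis.Complex_Analysis"
    "HOL-Computational_Algebra.Field_as_Ring"
    "Jordan_Normal_Form.Schur_Decomposition"
    "Subresultants.Subresultant_Gcd"
begin

text \<open>By triangularisation, the zeros of \<^const>\<open>CVD_poly\<close> are the values of \<open>P\<close> at the zeros of
  \<open>P'\<close>, with multiplicities; a non-zero discriminant makes these values, and a fortiori the critical
  points, distinct.

  For the monodromy, call two points of a fibre linked if they are equal or their transposition is
  induced by a loop. This is an equivalence relation preserved by lifting paths, so its classes have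
  constant size \<open>d\<close>, and \<open>d \<ge> 2\<close> because a small loop around a simple critical value induces a
  transposition. The product of \<open>z - k\<close> over the class of \<open>y\<close> is a single-valued holomorphic function of
  \<open>y\<close>, hence a polynomial of degree \<open>d\<close> whose fibres are the classes, and \<open>P\<close> is a polynomial in it.
  Such a decomposition is incompatible with simple critical points and distinct critical values unless
  \<open>d = m\<close>. So every transposition is induced by a loop.\<close>

subsection \<open>The critical values discriminant\<close>

text \<open>Behind the argument stands a fact on permutation groups: a primitive group that contains
  a transposition is the full symmetric group. The classes of \<open>linked\<close> are blocks of
  imprimitivity, and by Ritt's correspondence blocks belong to decompositions
  \<open>p = pcompose h q\<close>. The point of this route is that a loop has to be lifted
  explicitly around one critical value only; the global topology enters through connectedness of the
  regular points, and function theory turns a block system into a polynomial. Transitivity is hidden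
  in that connectedness: a path between two points of a fibre projects to a loop that carries one to
  the other.\<close>

lemma poly_mat_carrier [simp]: "A \<in> carrier_mat n n \<Longrightarrow> poly_mat p A \<in> carrier_mat n n"
  by (simp add: poly_mat_def)

lemma triple_mult_index:
  fixes P :: "'a::comm_ring_1 mat"
  assumes "P \<in> carrier_mat n n" "B \<in> carrier_mat n n" "Q \<in> carrier_mat n n" "i < n" "j < n"
  shows "(P * B * Q) $$ (i, j) = (\<Sum>s<n. \<Sum>r<n. P $$ (i, r) * B $$ (r, s) * Q $$ (s, j))"
proof -
  have "(P * B * Q) $$ (i, j) = (\<Sum>r<n. \<Sum>s<n. P $$ (i, r) * B $$ (r, s) * Q $$ (s, j))"
    using assms by (simp add: scalar_prod_def sum_distrib_left atLeast0LessThan mult.assoc)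
  then show ?thesis by (subst sum.swap)
qed

text \<open>Conjugation commutes with powers and is linear. Linearity is checked on entries because
  \<open>poly_mat\<close> is defined entry by entry; \<open>triple_mult_index\<close> serves this
  purpose.\<close>

lemma similar_mat_poly_mat:
  fixes A :: "'a::comm_ring_1 mat"
  assumes "similar_mat A B"
  shows "similar_mat (poly_mat p A) (poly_mat p B)"
proof -
  obtain P Q where wit: "similar_mat_wit A B P Q" using assms by (auto simp: similar_mat_def)
  define n where "n = dim_row A"
  note D = similar_mat_witD[OF n_def wit]
  have "poly_mat p A = P * poly_mat p B * Q"
  proof (rule eq_matI)
    fix i j assume "i < dim_row (P * poly_mat p B * Q)" "j < dim_col (P * poly_mat p B * Q)"
    then have ij: "i < n" "j < n" using D by auto
    have "poly_mat p A $$ (i, j) = (\<Sum>k\<le>degree p. coeff p k * (P * B ^\<^sub>m k * Q) $$ (i, j))"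
      using ij by (simp add: poly_mat_def flip: n_def similar_mat_wit_pow_id[OF wit])
    also have "\<dots> = (\<Sum>k\<le>degree p. coeff p k * (\<Sum>s<n. \<Sum>r<n. P $$ (i, r) * (B ^\<^sub>m k) $$ (r, s) * Q $$ (s, j)))"
      using ij D by (intro sum.cong refl arg_cong2[where f="(*)"] triple_mult_index) auto
    also have "\<dots> = (\<Sum>s<n. \<Sum>r<n. P $$ (i, r) * (\<Sum>k\<le>degree p. coeff p k * (B ^\<^sub>m k) $$ (r, s)) * Q $$ (s, j))"
      unfolding sum_distrib_left sum_distrib_right
      by (rule trans[OF sum.swap], rule sum.cong[OF refl], rule trans[OF sum.swap],
        rule sum.cong[OF refl], rule sum.cong[OF refl]) (simp add: ac_simps)
    also have "\<dots> = (\<Sum>s<n. \<Sum>r<n. P $$ (i, r) * poly_mat p B $$ (r, s) * Q $$ (s, j))"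
      using D by (intro sum.cong refl) (simp add: poly_mat_def)
    also have "\<dots> = (P * poly_mat p B * Q) $$ (i, j)"
      using ij D by (intro triple_mult_index[symmetric]) auto
    finally show "poly_mat p A $$ (i, j) = (P * poly_mat p B * Q) $$ (i, j)" .
  qed (use D in \<open>auto simp: poly_mat_def\<close>)
  then have "similar_mat_wit (poly_mat p A) (poly_mat p B) P Q"
    using D by (intro similar_mat_witI[of _ _ n]) auto
  then show ?thesis by (auto simp: similar_mat_def)
qed

lemma upper_triangular_mult:
  fixes A :: "'a::comm_ring_1 mat"
  assumes A: "A \<in> carrier_mat n n" "upper_triangular A"
    and B: "B \<in> carrier_mat n n" "upper_triangular B"
  shows "upper_triangular (A * B)"
    and "i < n \<Longrightarrow> (A * B) $$ (i, i) = A $$ (i, i) * B $$ (i, i)"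
proof -
  have entry: "(A * B) $$ (i, j) = (\<Sum>k<n. A $$ (i, k) * B $$ (k, j))" if "i < n" "j < n" for i j
    using that A B by (simp add: scalar_prod_def atLeast0LessThan)
  \<comment> \<open>One of the two factors lies below the diagonal: \<open>k < i\<close> kills the
    first, and \<open>k >= i\<close> forces \<open>j < k\<close>, which kills the second.\<close>
  have "A $$ (i, k) * B $$ (k, j) = 0" if "i < n" "k < n" "j < i \<or> j = i \<and> k \<noteq> i" for i j k
  proof (cases "k < i")
    case True
    then show ?thesis using A that upper_triangularD[OF A(2) True] by auto
  next
    case False
    then have "j < k" using that by auto
    then show ?thesis using B that upper_triangularD[OF B(2)] by auto
  qed note z = this
  show "upper_triangular (A * B)"
  proof (rule upper_triangularI)
    fix i j assume "j < i" "i < dim_row (A * B)"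
    then show "(A * B) $$ (i, j) = 0" using A entry[of i j] z[of i _ j] by (simp del: index_mult_mat(1))
  qed
  assume i: "i < n"
  have "(\<Sum>k<n. A $$ (i, k) * B $$ (k, i)) = (\<Sum>k\<in>{i}. A $$ (i, k) * B $$ (k, i))"
    using i by (intro sum.mono_neutral_right) (auto intro: z)
  then show "(A * B) $$ (i, i) = A $$ (i, i) * B $$ (i, i)" using entry[OF i i] by simp
qed

lemma upper_triangular_pow:
  fixes A :: "'a::comm_ring_1 mat"
  assumes A: "A \<in> carrier_mat n n" "upper_triangular A"
  shows "upper_triangular (A ^\<^sub>m k) \<and> (\<forall>i<n. (A ^\<^sub>m k) $$ (i, i) = (A $$ (i, i)) ^ k)"
proof (induction k)
  case 0
  then show ?case using A by auto
next
  case (Suc k)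
  then show ?case using upper_triangular_mult[of "A ^\<^sub>m k" n A] A
    by (simp add: pow_carrier_mat mult.commute del: index_mult_mat(1))
qed

lemma upper_triangular_poly_mat:
  fixes A :: "'a::comm_ring_1 mat"
  assumes A: "A \<in> carrier_mat n n" "upper_triangular A"
  shows "upper_triangular (poly_mat p A)" "diag_mat (poly_mat p A) = map (poly p) (diag_mat A)"
proof -
  have low: "(A ^\<^sub>m k) $$ (i, j) = 0" if "j < i" "i < n" for i j k
  proof (rule upper_triangularD)
    show "upper_triangular (A ^\<^sub>m k)" using upper_triangular_pow[OF A] by blast
  qed (use that A pow_carrier_mat[OF A(1)] in auto)
  show "upper_triangular (poly_mat p A)"
    using A by (intro upper_triangularI) (auto simp: poly_mat_def low)
  show "diag_mat (poly_mat p A) = map (poly p) (diag_mat A)"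
    using A upper_triangular_pow[OF A]
    by (auto simp: diag_mat_def poly_mat_def poly_altdef)
qed

text \<open>Spectral mapping with multiplicities. The list \<open>es\<close> is handed to the Schur
  decomposition, so the triangular matrix has exactly \<open>es\<close> as its diagonal and the
  polynomial can be applied to the list.\<close>

lemma char_poly_poly_mat:
  fixes A :: "complex mat"
  assumes A: "A \<in> carrier_mat n n" and es: "char_poly A = (\<Prod>e\<leftarrow>es. [:- e, 1:])"
  shows "char_poly (poly_mat p A) = (\<Prod>e\<leftarrow>es. [:- poly p e, 1:])"
proof -
  obtain B P Q where sd: "schur_decomposition A es = (B, P, Q)" by (cases "schur_decomposition A es")
  have wit: "similar_mat_wit A B P Q" and ut: "upper_triangular B" and diag: "diag_mat B = es"
    using schur_decomposition[OF A es sd] by auto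
  have B: "B \<in> carrier_mat n n" using similar_mat_witD2[OF A wit] by auto
  have "char_poly (poly_mat p A) = char_poly (poly_mat p B)"
    using wit by (intro char_poly_similar similar_mat_poly_mat) (auto simp: similar_mat_def)
  also have "\<dots> = (\<Prod>e\<leftarrow>diag_mat (poly_mat p B). [:- e, 1:])"
    using B ut by (intro char_poly_upper_triangular[of _ n] upper_triangular_poly_mat(1)[of _ n]) auto
  finally show ?thesis
    using upper_triangular_poly_mat(2)[OF B ut] by (simp add: diag o_def)
qed

section \<open>Companion matrices and the roots of \<open>CVD_poly\<close>\<close>

lemma companion_mat_carrier [simp]: "companion_mat q \<in> carrier_mat (degree q) (degree q)"
  by (simp add: companion_mat_def Let_def)

lemma uminus_one_poly: "[:- 1:] = (- 1 :: 'a::comm_ring_1 poly)"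
  by (simp only: one_pCons minus_pCons minus_zero)

text \<open>The difference form treats the corner uniformly, where the diagonal and the last column
  meet.\<close>

lemma char_poly_matrix_companion_mat:
  assumes "i < degree q" "j < degree q"
  shows "char_poly_matrix (companion_mat q) $$ (i, j) = (if i = j then [:0, 1:] else 0)
    - (if j = degree q - 1 then [:- coeff q i:] else if i = j + 1 then 1 else 0)"
proof -
  have "dim_row (companion_mat q) = degree q" "dim_col (companion_mat q) = degree q"
    by (simp_all add: companion_mat_def Let_def)
  moreover have "companion_mat q $$ (i, j) =
      (if j = degree q - 1 then - coeff q i else if i = j + 1 then 1 else 0)"
    using assms by (simp add: companion_mat_def Let_def)
  ultimately show ?thesis using assms unfolding char_poly_matrix_def by (simp add: uminus_one_poly)
qed

text \<open>Multiplying \<open>x I - C\<close> from the left by the unitriangular matrix with first row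
  \<open>1, x, \<dots>, x\<^bsup>n-1\<^esup>\<close> replaces its first row by \<open>0, \<dots>, 0, q\<close>.\<close>

lemma char_poly_companion_mat:
  fixes q :: "'a::comm_ring_1 poly"
  assumes monic: "lead_coeff q = 1" and deg: "degree q > 0"
  shows "char_poly (companion_mat q) = q"
proof -
  define n where "n = degree q"
  define X where "X = char_poly_matrix (companion_mat q)"
  have n: "n > 0" using deg by (simp add: n_def)
  have X: "X \<in> carrier_mat n n" unfolding X_def n_def by simp
  have Xe: "X $$ (i, j) = (if i = j then [:0, 1:] else 0)
      - (if j = n - 1 then [:- coeff q i:] else if i = j + 1 then 1 else 0)" if "i < n" "j < n" for i j
    using that unfolding X_def n_def by (rule char_poly_matrix_companion_mat)
  define L where "L = mat n n (\<lambda>(i, j). if i = 0 then monom (1::'a) j else if i = j then 1 else 0)"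
  have L: "L \<in> carrier_mat n n" by (simp add: L_def)
  have "det L = prod_list (diag_mat L)"
    using L by (intro det_upper_triangular) (auto simp: L_def)
  also have "diag_mat L = map (\<lambda>_. 1) [0..<n]"
    unfolding diag_mat_def L_def by auto
  finally have detL: "det L = 1" by (simp add: map_replicate_const)
  have LX: "(L * X) $$ (i, j) = (\<Sum>k<n. L $$ (i, k) * X $$ (k, j))" if "i < n" "j < n" for i j
    using that L X by (simp add: scalar_prod_def atLeast0LessThan)
  have row: "(L * X) $$ (i, j) = X $$ (i, j)" if "0 < i" "i < n" "j < n" for i j
  proof -
    have "(\<Sum>k<n. L $$ (i, k) * X $$ (k, j)) = (\<Sum>k\<in>{i}. L $$ (i, k) * X $$ (k, j))"
      using that by (intro sum.mono_neutral_right) (auto simp: L_def)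
    then show ?thesis using that LX[OF that(2,3)] by (simp add: L_def)
  qed
  have monom_x: "monom (1::'a) k * [:0, 1:] = monom 1 (Suc k)" for k
    by (simp add: monom_Suc)
  have monom_c: "monom (1::'a) k * [:c:] = monom c k" for k c
    by (metis mult_monom add_0_right mult_1 monom_0)
  \<comment> \<open>Column \<open>j\<close> of \<open>X\<close> has only \<open>x\<close> in row
    \<open>j\<close> and -1 in row \<open>j + 1\<close>; weighted with the powers of
    \<open>x\<close> in the first row of \<open>L\<close> they cancel.\<close>
  have row0: "(L * X) $$ (0, j) = 0" if "j < n - 1" for j
  proof -
    have "(\<Sum>k<n. L $$ (0, k) * X $$ (k, j)) = (\<Sum>k\<in>{j, Suc j}. L $$ (0, k) * X $$ (k, j))"
      using that by (intro sum.mono_neutral_right) (auto simp: Xe)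
    also have "\<dots> = monom 1 j * [:0, 1:] - monom 1 (Suc j)"
      using that by (simp add: Xe L_def)
    also have "\<dots> = 0" by (simp add: monom_Suc)
    finally show ?thesis using that n LX[of 0 j] by simp
  qed
  \<comment> \<open>The last column lists the coefficients of \<open>q\<close> below the leading
    one. The additional \<open>x\<close> in the corner contributes \<open>x^n\<close>, which is the
    leading term since \<open>q\<close> is monic.\<close>
  have row0': "(L * X) $$ (0, n - 1) = q"
  proof -
    have "(L * X) $$ (0, n - 1) = (\<Sum>k<n. monom 1 k * X $$ (k, n - 1))"
      using n LX[of 0 "n - 1"] by (simp add: L_def)
    also have "\<dots> = (\<Sum>k<n. (if k = n - 1 then monom 1 n else 0) + monom (coeff q k) k)"
    proof (intro sum.cong refl)
      fix k assume "k \<in> {..<n}"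
      then show "monom 1 k * X $$ (k, n - 1) = (if k = n - 1 then monom 1 n else 0) + monom (coeff q k) k"
        using n monom_c[of k "coeff q k"] monom_x[of k]
        by (cases "k = n - 1") (simp_all add: Xe distrib_left)
    qed
    also have "\<dots> = monom (coeff q n) n + (\<Sum>k<n. monom (coeff q k) k)"
      using n monic by (simp add: sum.distrib n_def)
    also have "\<dots> = q"
      using poly_as_sum_of_monoms[of q] by (simp add: n_def lessThan_Suc_atMost[symmetric] add.commute)
    finally show ?thesis .
  qed
  \<comment> \<open>Without the first row and the last column, the entries -1 of the subdiagonal
    become the diagonal of an upper triangular matrix. The resulting sign cancels that of the
    cofactor at \<open>(0, n - 1)\<close>.\<close>
  have D: "det (mat_delete (L * X) 0 (n - 1)) = (-1) ^ (n - 1)"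
  proof -
    let ?D = "mat_delete (L * X) 0 (n - 1)"
    have D: "?D \<in> carrier_mat (n - 1) (n - 1)" using L X by (simp add: mat_delete_def)
    have De: "?D $$ (i, j) = X $$ (Suc i, j)" if "i < n - 1" "j < n - 1" for i j
    proof -
      have "?D $$ (i, j) = (L * X) $$ (Suc i, j)"
        using that L X by (simp add: mat_delete_def del: index_mult_mat(1))
      then show ?thesis using that row[of "Suc i" j] by simp
    qed
    have "det ?D = prod_list (diag_mat ?D)"
      using D by (intro det_upper_triangular[of _ "n - 1"] upper_triangularI) (auto simp: De Xe carrier_matD[OF L] carrier_matD[OF X] simp del: One_nat_def)
    also have "diag_mat ?D = map (\<lambda>_. - 1) [0..<n - 1]"
      unfolding diag_mat_def by (auto simp: De Xe carrier_matD[OF L] carrier_matD[OF X] simp del: One_nat_def)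
    finally show ?thesis by (simp add: map_replicate_const)
  qed
  have "det X = det (L * X)" using det_mult[OF L X] detL by simp
  also have "\<dots> = (\<Sum>j<n. (L * X) $$ (0, j) * cofactor (L * X) 0 j)"
    using L X n by (intro laplace_expansion_row) auto
  also have "\<dots> = (\<Sum>j\<in>{n - 1}. (L * X) $$ (0, j) * cofactor (L * X) 0 j)"
  proof (intro sum.mono_neutral_right ballI)
    fix j assume "j \<in> {..<n} - {n - 1}"
    then have "j < n - 1" by auto
    then show "(L * X) $$ (0, j) * cofactor (L * X) 0 j = 0" using row0[of j] by simp
  qed (use n in auto)
  also have "\<dots> = q"
  proof -
    have "(-1) ^ (n - 1) * (-1) ^ (n - 1) = (1 :: 'a poly)" by (simp flip: power_mult_distrib)
    then show ?thesis using D row0' unfolding cofactor_def by (simp del: index_mult_mat(1))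
  qed
  finally show ?thesis by (simp add: char_poly_def X_def)
qed

lemma coeff_monic_poly: "coeff (monic_poly m a) i = (if i = m then 1 else if i < m then a i else 0)"
  by (simp add: monic_poly_def coeff_sum)

lemma degree_monic_poly: "degree (monic_poly m a) = m"
proof (rule antisym)
  show "degree (monic_poly m a) \<le> m" by (rule degree_le) (simp add: coeff_monic_poly)
  show "m \<le> degree (monic_poly m a)" by (rule le_degree) (simp add: coeff_monic_poly)
qed

text \<open>The sign reflects that \<open>CVD_poly\<close> takes the determinant of
  \<open>M - y I\<close>, of size \<open>m - 1\<close>, and \<open>char_poly\<close> that of
  \<open>y I - M\<close>.\<close>

lemma CVD_poly_eq:
  assumes m: "m \<ge> 2"
    and es: "Polynomial.smult (1 / of_nat m) (pderiv (monic_poly m a)) = (\<Prod>e\<leftarrow>es. [:- e, 1:])"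
  shows "CVD_poly m a = (-1) ^ (m - 1) * (\<Prod>e\<leftarrow>es. [:- poly (monic_poly m a) e, 1:])"
    (is "_ = _ * ?R")
proof -
  let ?q = "Polynomial.smult (1 / of_nat m) (pderiv (monic_poly m a))"
  have deg: "degree ?q = m - 1" and monic: "lead_coeff ?q = 1"
    using m by (simp_all add: degree_pderiv degree_monic_poly coeff_pderiv coeff_monic_poly)
  have M: "CVD_mat m a \<in> carrier_mat (m - 1) (m - 1)"
    unfolding CVD_mat_def using companion_mat_carrier[of ?q] deg by simp
  have "char_poly (companion_mat ?q) = ?q"
    using m deg monic by (intro char_poly_companion_mat) auto
  then have *: "char_poly (CVD_mat m a) = ?R"
    unfolding CVD_mat_def es by (rule char_poly_poly_mat[OF companion_mat_carrier])
  have "map_mat (\<lambda>c. [:c:]) (CVD_mat m a) - [:0, 1:] \<cdot>\<^sub>m 1\<^sub>m (m - 1)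
      = - 1 \<cdot>\<^sub>m char_poly_matrix (CVD_mat m a)"
    using M by (intro eq_matI) (auto simp: char_poly_matrix_def)
  then have "CVD_poly m a = (-1) ^ (m - 1) * char_poly (CVD_mat m a)"
    unfolding CVD_poly_def char_poly_def using carrier_matD(2)[OF char_poly_matrix_closed[OF M]]
    by (simp add: det_smult)
  then show ?thesis using * by simp
qed

section \<open>Discriminants and repeated roots\<close>

lemma discriminant_eq_0:
  fixes f :: "complex poly"
  assumes "poly f v = 0" "poly (pderiv f) v = 0"
  shows "discriminant f = 0"
proof -
  have "[:- v, 1:] dvd gcd f (pderiv f)" using assms by (simp add: poly_eq_0_iff_dvd)
  \<comment> \<open>The zero polynomial is kept apart: its discriminant is 0 because division by its
    leading coefficient 0 yields 0.\<close>
  moreover have "gcd f (pderiv f) \<noteq> 0 \<or> f = 0" by auto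
  ultimately have "resultant f (pderiv f) = 0 \<or> f = 0"
    using dvd_imp_degree_le[of "[:- v, 1:]" "gcd f (pderiv f)"] by (auto simp: resultant_0_gcd)
  then show ?thesis by (auto simp: discriminant_def)
qed

lemma poly_prod_list_linear_eq_0:
  fixes es :: "'a::idom list"
  shows "poly (\<Prod>e\<leftarrow>es. [:- e, 1:]) y = 0 \<longleftrightarrow> y \<in> set es"
  by (induction es) auto

text \<open>Below, this tells simple roots from multiple ones: the root is simple exactly if the
  cofactor does not vanish there.\<close>

lemma poly_pderiv_linear_factor:
  fixes h :: "'a::idom poly"
  shows "poly (pderiv ([:- v, 1:] * h)) v = poly h v"
  unfolding pderiv_mult by (simp add: pderiv_pCons)

lemma prod_list_double_root:
  fixes vs :: "'a::idom list"
  assumes "\<not> distinct vs"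
  shows "\<exists>v. poly (\<Prod>v\<leftarrow>vs. [:- v, 1:]) v = 0 \<and> poly (pderiv (\<Prod>v\<leftarrow>vs. [:- v, 1:])) v = 0"
proof -
  obtain xs ys zs v where vs: "vs = xs @ [v] @ ys @ [v] @ zs" using not_distinct_decomp[OF assms] by blast
  define h where "h = (\<Prod>v\<leftarrow>xs. [:- v, 1:]) * (\<Prod>v\<leftarrow>ys. [:- v, 1:]) * (\<Prod>v\<leftarrow>zs. [:- v, 1:])"
  have "(\<Prod>v\<leftarrow>vs. [:- v, 1:]) = [:- v, 1:] * ([:- v, 1:] * h)"
    unfolding vs h_def map_append prod_list.append by (simp only: list.map prod_list.Cons prod_list.Nil mult_ac mult_1)
  then show ?thesis using poly_pderiv_linear_factor[of v "[:- v, 1:] * h"] by (intro exI[of _ v]) simp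
qed

lemma CVD_nonzero_distinct:
  assumes m: "m \<ge> 2" and cvd: "CVD m a \<noteq> 0"
    and es: "Polynomial.smult (1 / of_nat m) (pderiv (monic_poly m a)) = (\<Prod>e\<leftarrow>es. [:- e, 1:])"
  shows "distinct (map (poly (monic_poly m a)) es)"
proof (rule ccontr)
  let ?R = "\<Prod>v\<leftarrow>map (poly (monic_poly m a)) es. [:- v, 1:]"
  assume "\<not> ?thesis"
  from prod_list_double_root[OF this] obtain v where v: "poly ?R v = 0" "poly (pderiv ?R) v = 0" by blast
  have "CVD_poly m a = ?R \<or> CVD_poly m a = - ?R"
    using CVD_poly_eq[OF m es] by (cases "even (m - 1)") (simp_all add: o_def)
  then have "poly (CVD_poly m a) v = 0" "poly (pderiv (CVD_poly m a)) v = 0"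
    using v by (auto simp: pderiv_minus)
  then show False using cvd discriminant_eq_0 unfolding CVD_def by blast
qed

lemma CVD_nonzero_imp:
  assumes m: "m \<ge> 2" and cvd: "CVD m a \<noteq> 0"
  shows "\<forall>y \<in> critical_points (monic_poly m a). nondegenerate (monic_poly m a) y"
    and "inj_on (poly (monic_poly m a)) (critical_points (monic_poly m a))"
proof -
  let ?p = "monic_poly m a" and ?q = "Polynomial.smult (1 / of_nat m) (pderiv (monic_poly m a))"
  have monic: "lead_coeff ?q = 1"
    using m by (simp add: degree_pderiv degree_monic_poly coeff_pderiv coeff_monic_poly)
  obtain es where es: "?q = (\<Prod>e\<leftarrow>es. [:- e, 1:])"
    using fundamental_theorem_algebra_factorized[of ?q] monic by (metis smult_1_left)
  have d: "distinct (map (poly ?p) es)" by (rule CVD_nonzero_distinct[OF m cvd es])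
  have "poly (pderiv ?p) y = 0 \<longleftrightarrow> poly ?q y = 0" for y using m by simp
  then have crit: "critical_points ?p = set es"
    unfolding critical_points_def es poly_prod_list_linear_eq_0 by simp
  show "inj_on (poly ?p) (critical_points ?p)" using d crit by (simp add: distinct_map)
  show "\<forall>y \<in> critical_points ?p. nondegenerate ?p y"
  proof
    fix y assume "y \<in> critical_points ?p"
    then have "y \<in> set es" using crit by simp
    then obtain xs ys where split: "es = xs @ [y] @ ys" by (auto simp: in_set_conv_decomp)
    then have y: "y \<notin> set xs" "y \<notin> set ys" using d by (auto simp: distinct_map)
    have "?q = [:- y, 1:] * ((\<Prod>e\<leftarrow>xs. [:- e, 1:]) * (\<Prod>e\<leftarrow>ys. [:- e, 1:]))"
      unfolding es split map_append prod_list.append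
      by (simp only: list.map prod_list.Cons prod_list.Nil mult_ac mult_1)
    then have "poly (pderiv ?q) y \<noteq> 0"
      using y by (simp only: poly_pderiv_linear_factor poly_mult mult_eq_0_iff poly_prod_list_linear_eq_0 simp_thms)
    then show "nondegenerate ?p y" by (simp add: nondegenerate_def pderiv_smult)
  qed
qed

subsection \<open>Polynomials as covering maps\<close>

lemma finite_separation:
  fixes F :: "'a::metric_space set"
  assumes "finite F"
  shows "\<exists>e>0. \<forall>y\<in>F. \<forall>z\<in>F. y \<noteq> z \<longrightarrow> ball y e \<inter> ball z e = {}"
proof -
  define D where "D = (\<lambda>(y, z). dist y z) ` {(y, z) \<in> F \<times> F. y \<noteq> z}"
  have "finite D" unfolding D_def using assms by (intro finite_imageI finite_subset[OF _ finite_cartesian_product[OF assms assms]]) auto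
  \<comment> \<open>Half the least distance between different points. The 1 keeps \<open>Min\<close>
    meaningful when \<open>F\<close> has at most one point.\<close>
  define e where "e = Min (insert 1 D) / 2"
  have "\<forall>x\<in>insert 1 D. x > 0" by (auto simp: D_def)
  then have "e > 0" unfolding e_def using \<open>finite D\<close> by auto
  moreover have "ball y e \<inter> ball z e = {}" if "y \<in> F" "z \<in> F" "y \<noteq> z" for y z
  proof -
    have "dist y z \<in> D" unfolding D_def using that by force
    then have "2 * e \<le> dist y z" unfolding e_def using \<open>finite D\<close> by simp
    then show ?thesis using dist_triangle_half_l[of y _ "2 * e" z] by (force simp: dist_commute)
  qed
  ultimately show ?thesis by blast
qed

text \<open>The branch is the holomorphic local inverse of \<open>p\<close> at a point where
  \<open>p'\<close> does not vanish. The bound \<open>e\<close> on its range will keep the branches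
  through different points of a fibre apart.\<close>

lemma simple_root_branch:
  fixes p :: "complex poly"
  assumes "poly (pderiv p) y \<noteq> 0" "e > 0"
  shows "\<exists>r>0. \<exists>s. s holomorphic_on ball (poly p y) r \<and> s (poly p y) = y \<and>
    s ` ball (poly p y) r \<subseteq> ball y e \<and> (\<forall>w\<in>ball (poly p y) r. poly p (s w) = w)"
proof -
  have hol: "poly p holomorphic_on S" for S by (intro holomorphic_intros)
  have "deriv (poly p) y = poly (pderiv p) y" by (intro DERIV_imp_deriv poly_DERIV)
  with assms obtain q where q: "q > 0" "ball y q \<subseteq> ball y e" "open (poly p ` ball y q)" "inj_on (poly p) (ball y q)"
    using has_complex_derivative_locally_invertible[OF hol, of y "ball y e"] by (metis centre_in_ball open_ball)
  obtain s where s: "s holomorphic_on poly p ` ball y q" "\<And>z. z \<in> ball y q \<Longrightarrow> s (poly p z) = z"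
    using holomorphic_has_inverse[OF hol open_ball q(4)] by metis
  have "poly p y \<in> poly p ` ball y q" using q(1) by simp
  then obtain r where r: "r > 0" "ball (poly p y) r \<subseteq> poly p ` ball y q"
    using q(3) by (meson openE)
  show ?thesis
  proof (intro exI conjI)
    show "s holomorphic_on ball (poly p y) r" using s(1) r(2) by (rule holomorphic_on_subset)
    show "s ` ball (poly p y) r \<subseteq> ball y e" using r(2) s(2) q(2) by fastforce
    show "\<forall>w\<in>ball (poly p y) r. poly p (s w) = w" using r(2) s(2) by fastforce
  qed (use r s q in auto)
qed

lemma simple_roots_branches:
  fixes p :: "complex poly"
  assumes F: "finite F" and root: "\<And>y. y \<in> F \<Longrightarrow> poly p y = x \<and> poly (pderiv p) y \<noteq> 0" and e: "e > 0"
  shows "\<exists>r>0. \<exists>s. \<forall>y\<in>F. s y holomorphic_on ball x r \<and> s y x = y \<and>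
    s y ` ball x r \<subseteq> ball y e \<and> (\<forall>w\<in>ball x r. poly p (s y w) = w)"
proof -
  have "\<forall>y\<in>F. \<exists>r s. r > 0 \<and> s holomorphic_on ball x r \<and> s x = y \<and>
    s ` ball x r \<subseteq> ball y e \<and> (\<forall>w\<in>ball x r. poly p (s w) = w)"
    using simple_root_branch[OF _ e] root by metis
  then obtain R s where s: "\<forall>y\<in>F. R y > 0 \<and> s y holomorphic_on ball x (R y) \<and> s y x = y \<and>
    s y ` ball x (R y) \<subseteq> ball y e \<and> (\<forall>w\<in>ball x (R y). poly p (s y w) = w)"
    by metis
  \<comment> \<open>The 1 covers an empty \<open>F\<close>, which does occur: for a quadratic
    polynomial the fibre over the critical value consists of the critical point alone.\<close>
  define r where "r = Min (insert 1 (R ` F))"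
  have "r > 0" unfolding r_def using F s by auto
  moreover have "ball x r \<subseteq> ball x (R y)" if "y \<in> F" for y
    using F that unfolding r_def by (intro subset_ball) simp
  ultimately show ?thesis using s by (intro exI[of _ r] conjI exI[of _ s]) (blast intro: holomorphic_on_subset)+
qed

lemma card_roots_rsquarefree:
  fixes q :: "complex poly"
  assumes "rsquarefree q"
  shows "card {z. poly q z = 0} = degree q"
proof -
  have "q \<noteq> 0" using assms by (auto simp: rsquarefree_def)
  have "degree q = degree (Polynomial.smult (lead_coeff q) (\<Prod>z|poly q z = 0. [:- z, 1:]))"
    using complex_poly_decompose_rsquarefree[OF assms] by simp
  also have "\<dots> = card {z. poly q z = 0}" using \<open>q \<noteq> 0\<close> by (simp add: degree_prod_eq_sum_degree)
  finally show ?thesis ..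
qed

section \<open>The covering over the regular values\<close>

locale nonconst_poly =
  fixes p :: "complex poly"
  assumes deg: "degree p > 0"
begin

abbreviation regular_points :: "complex set" where
  "regular_points \<equiv> - (poly p -` critical_values p)"

lemma finite_critical_points: "finite (critical_points p)"
  unfolding critical_points_def using deg by (intro poly_roots_finite) (simp add: pderiv_eq_0_iff)

lemma finite_critical_values: "finite (critical_values p)"
  unfolding critical_values_def by (intro finite_imageI finite_critical_points)

lemma fibre_roots: "fibre p x = {y. poly (p - [:x:]) y = 0}"
  by (auto simp: fibre_def)

lemma degree_diff_const: "degree (p - [:x:]) = degree p"
  unfolding diff_conv_add_uminus using deg by (intro degree_add_eq_left) simp

lemma finite_fibre: "finite (fibre p x)"
  unfolding fibre_roots using degree_diff_const[of x] deg by (intro poly_roots_finite) auto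

lemma finite_preimage: "finite S \<Longrightarrow> finite (poly p -` S)"
proof -
  assume "finite S"
  moreover have "poly p -` S = (\<Union>x\<in>S. fibre p x)" by (auto simp: fibre_def)
  ultimately show ?thesis using finite_fibre by simp
qed

lemma open_regular_values: "open (- critical_values p)"
  using finite_critical_values by (simp add: finite_imp_closed open_Compl)

lemma finite_singular_points: "finite (poly p -` critical_values p)"
  by (intro finite_preimage finite_critical_values)

lemma open_regular_points: "open regular_points"
  using finite_singular_points by (simp add: finite_imp_closed open_Compl)

lemma path_connected_regular_points: "path_connected regular_points"
  by (intro path_connected_complement_countable uncountable_infinite countable_finite finite_singular_points) simp

lemma card_fibre:
  assumes "x \<notin> critical_values p"
  shows "card (fibre p x) = degree p"
proof -
  have "rsquarefree (p - [:x:])"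
    unfolding rsquarefree_roots using assms
    by (auto simp: critical_values_def critical_points_def pderiv_diff pderiv_pCons)
  from card_roots_rsquarefree[OF this] show ?thesis unfolding fibre_roots degree_diff_const .
qed

text \<open>Branches with disjoint ranges give different preimages of each \<open>w\<close> in the
  disc. That they give all preimages follows by counting, since the fibres over \<open>x\<close> and
  \<open>w\<close> both have \<open>degree p\<close> elements.\<close>

lemma evenly_covered:
  assumes x: "x \<notin> critical_values p"
  shows "\<exists>r>0. \<exists>s. ball x r \<subseteq> - critical_values p \<and>
    (\<forall>y\<in>fibre p x. s y holomorphic_on ball x r \<and> s y x = y \<and> (\<forall>w\<in>ball x r. poly p (s y w) = w)) \<and>
    (\<forall>w\<in>ball x r. bij_betw (\<lambda>y. s y w) (fibre p x) (fibre p w))"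
proof -
  obtain e where e: "e > 0" "\<And>y z. y \<in> fibre p x \<Longrightarrow> z \<in> fibre p x \<Longrightarrow> y \<noteq> z \<Longrightarrow> ball y e \<inter> ball z e = {}"
    using finite_separation[OF finite_fibre] by meson
  have "poly p y = x \<and> poly (pderiv p) y \<noteq> 0" if "y \<in> fibre p x" for y
    using that x by (auto simp: fibre_def critical_values_def critical_points_def)
  from simple_roots_branches[OF finite_fibre this e(1)] obtain r0 s where r0: "r0 > 0"
    and s: "\<forall>y\<in>fibre p x. s y holomorphic_on ball x r0 \<and> s y x = y \<and>
      s y ` ball x r0 \<subseteq> ball y e \<and> (\<forall>w\<in>ball x r0. poly p (s y w) = w)" by blast
  obtain r1 where r1: "r1 > 0" "ball x r1 \<subseteq> - critical_values p"
    using open_regular_values x by (meson ComplI openE)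
  define r where "r = min r0 r1"
  have r: "r > 0" "ball x r \<subseteq> - critical_values p" "ball x r \<subseteq> ball x r0"
    using r0 r1 by (auto simp: r_def)
  have "bij_betw (\<lambda>y. s y w) (fibre p x) (fibre p w)" if w: "w \<in> ball x r" for w
  proof -
    have inj: "inj_on (\<lambda>y. s y w) (fibre p x)"
    proof (rule inj_onI)
      fix y z assume yz: "y \<in> fibre p x" "z \<in> fibre p x" "s y w = s z w"
      then have "s y w \<in> ball y e \<inter> ball z e" using s w r(3) by (metis IntI image_subset_iff subsetD)
      then show "y = z" using e(2) yz by blast
    qed
    have sub: "(\<lambda>y. s y w) ` fibre p x \<subseteq> fibre p w"
      using s w r(3) by (auto simp: fibre_def)
    have "card ((\<lambda>y. s y w) ` fibre p x) = card (fibre p w)"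
      using card_image[OF inj] card_fibre x w r(2) by auto
    with inj sub show ?thesis
      using card_subset_eq[OF finite_fibre] by (metis bij_betw_imageI)
  qed
  then show ?thesis using r s by (intro exI[of _ r] conjI exI[of _ s]) (blast intro: holomorphic_on_subset)+
qed

text \<open>The sheets over a disc are its images under the branches. They are open by the open
  mapping theorem, and disjoint because a common point determines its value \<open>w\<close> and
  then, by injectivity at \<open>w\<close>, its branch.\<close>

lemma covering: "covering_space regular_points (poly p) (- critical_values p)"
proof
  show "continuous_on regular_points (poly p)" by (intro continuous_intros)
  have "\<exists>y\<in>regular_points. poly p y = x" if x: "x \<in> - critical_values p" for x
  proof -
    have "fibre p x \<noteq> {}" using card_fibre[of x] x deg by auto
    then show ?thesis using x by (auto simp: fibre_def)
  qed
  then show "poly p ` regular_points = - critical_values p" by auto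
next
  fix x assume "x \<in> - critical_values p"
  then have "x \<notin> critical_values p" by simp
  from evenly_covered[OF this] obtain r s where r: "r > 0" "ball x r \<subseteq> - critical_values p"
    and s0: "\<forall>y\<in>fibre p x. s y holomorphic_on ball x r \<and> s y x = y \<and> (\<forall>w\<in>ball x r. poly p (s y w) = w)"
    and bij: "\<forall>w\<in>ball x r. bij_betw (\<lambda>y. s y w) (fibre p x) (fibre p w)"
    by blast
  have s: "s y holomorphic_on ball x r" "w \<in> ball x r \<Longrightarrow> poly p (s y w) = w"
    if "y \<in> fibre p x" for y w
    using s0 that by blast+
  let ?v = "(\<lambda>y. s y ` ball x r) ` fibre p x"
  show "\<exists>T. x \<in> T \<and> openin (top_of_set (- critical_values p)) T \<and>
    (\<exists>v. \<Union>v = regular_points \<inter> poly p -` T \<and> (\<forall>u\<in>v. openin (top_of_set regular_points) u) \<and>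
      pairwise disjnt v \<and> (\<forall>u\<in>v. \<exists>q. homeomorphism u T (poly p) q))"
  proof (intro exI[of _ "ball x r"] exI[of _ ?v] conjI ballI)
    show "x \<in> ball x r" using r by simp
    show "openin (top_of_set (- critical_values p)) (ball x r)"
      using r(2) by (simp add: open_regular_values openin_open_eq)
    have sub: "s y w \<in> regular_points" if "y \<in> fibre p x" "w \<in> ball x r" for y w
      using s(2)[OF that] that(2) r(2) by auto
    show "\<Union>?v = regular_points \<inter> poly p -` ball x r"
    proof (intro equalityI subsetI)
      fix z assume "z \<in> \<Union>?v" then show "z \<in> regular_points \<inter> poly p -` ball x r" using sub s(2) by auto
    next
      fix z assume z: "z \<in> regular_points \<inter> poly p -` ball x r"
      then have "z \<in> (\<lambda>y. s y (poly p z)) ` fibre p x"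
        using bij by (auto simp: bij_betw_def fibre_def)
      then show "z \<in> \<Union>?v" using z by blast
    qed
    fix u assume "u \<in> ?v"
    then obtain y where y: "y \<in> fibre p x" "u = s y ` ball x r" by auto
    have inj: "inj_on (s y) (ball x r)" using s(2)[OF y(1)] by (metis inj_onI)
    show "openin (top_of_set regular_points) u"
      using open_mapping_thm3[OF s(1)[OF y(1)] open_ball inj] sub y
      by (auto simp: open_regular_points openin_open_eq)
    have "homeomorphism u (ball x r) (poly p) (s y)"
    proof
      show "continuous_on u (poly p)" by (intro continuous_intros)
      show "continuous_on (ball x r) (s y)" using s(1)[OF y(1)] by (rule holomorphic_on_imp_continuous_on)
    qed (use y s(2)[OF y(1)] in auto)
    then show "\<exists>q. homeomorphism u (ball x r) (poly p) q" by blast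
  next
    show "pairwise disjnt ?v"
    proof (intro pairwiseI)
      fix u v assume "u \<in> ?v" "v \<in> ?v" "u \<noteq> v"
      then obtain y z where yz: "y \<in> fibre p x" "u = s y ` ball x r" "z \<in> fibre p x" "v = s z ` ball x r"
        by auto
      show "disjnt u v"
      proof (rule ccontr)
        assume "\<not> disjnt u v"
        then obtain w w' where w: "w \<in> ball x r" "w' \<in> ball x r" "s y w = s z w'"
          unfolding disjnt_def yz by auto
        then have "w = w'" using s(2) yz by metis
        then have "y = z" using bij w yz by (auto simp: bij_betw_def inj_on_def)
        then show False using yz \<open>u \<noteq> v\<close> by simp
      qed
    qed
  qed
qed

section \<open>Lifting paths and composing loops\<close>

lemma lift_exists:
  assumes "path \<gamma>" "path_image \<gamma> \<subseteq> - critical_values p" "poly p y = pathstart \<gamma>"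
  obtains g where "is_lift p \<gamma> g" "pathstart g = y"
proof -
  have "pathstart \<gamma> \<in> path_image \<gamma>" by (rule pathstart_in_path_image)
  then have "y \<in> regular_points" using assms by auto
  then show ?thesis
    using covering_space_lift_path_strong[OF covering _ assms(1,2), of y] assms(3) that
    unfolding is_lift_def by metis
qed

text \<open>The time \<open>a\<close> of agreement is arbitrary so that agreement at the end also
  propagates back to the start.\<close>

lemma lift_unique:
  assumes g: "is_lift p \<gamma> g" and h: "is_lift p \<gamma> h" and "a \<in> {0..1}" "g a = h a" "t \<in> {0..1}"
  shows "g t = h t"
proof (rule covering_space_lift_unique[OF covering, of g a h "{0..1}" "poly p \<circ> g"])
  show "continuous_on {0..1} (poly p \<circ> g)"
    using g unfolding is_lift_def path_def by (intro continuous_on_compose continuous_intros) auto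
qed (use assms in \<open>auto simp: is_lift_def path_def path_image_def\<close>)

lemma lift_unique_finish:
  "is_lift p \<gamma> g \<Longrightarrow> is_lift p \<gamma> h \<Longrightarrow> pathstart g = pathstart h \<longleftrightarrow> pathfinish g = pathfinish h"
  unfolding pathstart_def pathfinish_def
  using lift_unique[of \<gamma> g h 0 1] lift_unique[of \<gamma> g h 1 0] by auto

lemma induced_by_compose:
  assumes \<sigma>: "induced_by p x \<gamma> \<sigma>" and \<tau>: "induced_by p x \<delta> \<tau>" and "\<tau> ` fibre p x \<subseteq> fibre p x"
  shows "induced_by p x (\<delta> +++ \<gamma>) (\<sigma> \<circ> \<tau>)"
  unfolding induced_by_def
proof
  fix y assume y: "y \<in> fibre p x"
  then obtain k where k: "is_lift p \<delta> k" "pathstart k = y" "pathfinish k = \<tau> y"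
    using \<tau> unfolding induced_by_def by blast
  have "\<tau> y \<in> fibre p x" using assms(3) y by blast
  then obtain l where l: "is_lift p \<gamma> l" "pathstart l = \<tau> y" "pathfinish l = \<sigma> (\<tau> y)"
    using \<sigma> unfolding induced_by_def by blast
  show "\<exists>h. is_lift p (\<delta> +++ \<gamma>) h \<and> pathstart h = y \<and> pathfinish h = (\<sigma> \<circ> \<tau>) y"
    using k l by (intro exI[of _ "k +++ l"]) (simp add: lift_join)
qed

lemma base_loop_join: "base_loop p x \<gamma> \<Longrightarrow> base_loop p x \<delta> \<Longrightarrow> base_loop p x (\<gamma> +++ \<delta>)"
  by (auto simp: base_loop_def path_image_join)

subsection \<open>Linked points of a fibre\<close>

text \<open>In contrast to the carrier of \<open>monodromy_group\<close>, \<sigma> is unconstrained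
  outside the fibre, so \<open>id\<close> and \<open>Transposition.transpose\<close> can be used as
  they stand.\<close>

definition attained :: "complex \<Rightarrow> (complex \<Rightarrow> complex) \<Rightarrow> bool" where
  "attained x \<sigma> \<longleftrightarrow> (\<exists>\<gamma>. base_loop p x \<gamma> \<and> induced_by p x \<gamma> \<sigma>)"

lemma attained_compose:
  assumes "attained x \<sigma>" "attained x \<tau>" "\<tau> ` fibre p x \<subseteq> fibre p x"
  shows "attained x (\<sigma> \<circ> \<tau>)"
proof -
  obtain \<gamma> \<delta> where \<gamma>: "base_loop p x \<gamma>" "induced_by p x \<gamma> \<sigma>" and \<delta>: "base_loop p x \<delta>" "induced_by p x \<delta> \<tau>"
    using assms(1,2) by (auto simp: attained_def)
  show ?thesis unfolding attained_def
    using base_loop_join[OF \<delta>(1) \<gamma>(1)] induced_by_compose[OF \<gamma>(2) \<delta>(2) assms(3)] by (intro exI conjI)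
qed

lemma attained_id:
  assumes "x \<notin> critical_values p"
  shows "attained x id"
proof -
  have "base_loop p x (\<lambda>_. x)"
    using assms by (auto simp: base_loop_def path_def path_image_def pathstart_def pathfinish_def)
  moreover have "induced_by p x (\<lambda>_. x) id"
    unfolding induced_by_def
  proof
    fix y assume "y \<in> fibre p x"
    then show "\<exists>g. is_lift p (\<lambda>_. x) g \<and> pathstart g = y \<and> pathfinish g = id y"
      using assms by (intro exI[of _ "\<lambda>_. y"])
        (auto simp: is_lift_def fibre_def path_def path_image_def pathstart_def pathfinish_def)
  qed
  ultimately show ?thesis unfolding attained_def by blast
qed

text \<open>The disjunct \<open>y = z\<close> makes the relation reflexive also at points over
  critical values, where no base loop exists.\<close>

definition linked :: "complex \<Rightarrow> complex \<Rightarrow> bool" where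
  "linked y z \<longleftrightarrow> poly p y = poly p z \<and> (y = z \<or> attained (poly p y) (Transposition.transpose y z))"

lemma linked_refl [simp]: "linked y y"
  by (simp add: linked_def)

lemma linked_sym: "linked y z \<Longrightarrow> linked z y"
  unfolding linked_def by (metis Transposition.transpose_commute)

lemma transpose_fibre: "y \<in> fibre p x \<Longrightarrow> z \<in> fibre p x \<Longrightarrow> Transposition.transpose y z ` fibre p x \<subseteq> fibre p x"
  by (auto simp: Transposition.transpose_def)

text \<open>For three different points, the transposition of \<open>x\<close> and \<open>z\<close>
  is that of \<open>y\<close> and \<open>z\<close> conjugated by that of \<open>x\<close> and
  \<open>y\<close>.\<close>

lemma linked_trans:
  assumes "linked x y" "linked y z"
  shows "linked x z"
proof (cases "x = y \<or> y = z \<or> x = z")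
  case True
  then show ?thesis using assms by auto
next
  case False
  define v where "v = poly p x"
  have v: "poly p x = v" "poly p y = v" "poly p z = v"
    using assms by (simp_all add: linked_def v_def)
  then have fib: "x \<in> fibre p v" "y \<in> fibre p v" "z \<in> fibre p v"
    by (simp_all add: fibre_def)
  have xy: "attained v (Transposition.transpose x y)" and yz: "attained v (Transposition.transpose y z)"
    using assms False v by (simp_all add: linked_def)
  have "attained v (Transposition.transpose x y \<circ> (Transposition.transpose y z \<circ> Transposition.transpose x y))"
  proof (rule attained_compose[OF xy attained_compose[OF yz xy]])
    show "(Transposition.transpose y z \<circ> Transposition.transpose x y) ` fibre p v \<subseteq> fibre p v"
      using transpose_fibre[OF fib(1,2)] transpose_fibre[OF fib(2,3)] unfolding image_comp[symmetric] by blast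
  qed (rule transpose_fibre[OF fib(1,2)])
  also have "Transposition.transpose x y \<circ> (Transposition.transpose y z \<circ> Transposition.transpose x y) = Transposition.transpose x z"
    using False by (auto simp: fun_eq_iff Transposition.transpose_def)
  finally show ?thesis using v by (simp add: linked_def)
qed

lemma lift_start: "is_lift p \<gamma> g \<Longrightarrow> poly p (pathstart g) = pathstart \<gamma>"
  by (simp add: is_lift_def pathstart_def)

lemma lift_finish: "is_lift p \<gamma> g \<Longrightarrow> poly p (pathfinish g) = pathfinish \<gamma>"
  by (simp add: is_lift_def pathfinish_def)

lemma lift_path_image: "is_lift p \<gamma> g \<Longrightarrow> path_image \<gamma> \<subseteq> - critical_values p"
  by (force simp: is_lift_def path_image_def)

lemma lift_path: "is_lift p \<gamma> g \<Longrightarrow> path \<gamma>"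
proof -
  assume g: "is_lift p \<gamma> g"
  then have "continuous_on {0..1} (\<lambda>t. poly p (g t))"
    unfolding is_lift_def path_def by (intro continuous_intros) auto
  then show "path \<gamma>" unfolding path_def
    by (rule continuous_on_eq) (use g in \<open>auto simp: is_lift_def\<close>)
qed

text \<open>Lifting \<delta> gives a bijection between the fibres over its two ends. Going back
  along \<delta>, around \<gamma> and forth along \<delta> induces the permutation of \<gamma>
  conjugated by this bijection, which is the transposition of the two end points.\<close>

lemma linked_transport:
  assumes g: "is_lift p \<delta> g" and h: "is_lift p \<delta> h" and link: "linked (pathstart g) (pathstart h)"
  shows "linked (pathfinish g) (pathfinish h)"
proof (cases "pathstart g = pathstart h")
  case True
  then show ?thesis using lift_unique_finish[OF g h] by simp
next
  case False
  define x where "x = pathstart \<delta>"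
  define x' where "x' = pathfinish \<delta>"
  obtain \<gamma> where \<gamma>: "base_loop p x \<gamma>" "induced_by p x \<gamma> (Transposition.transpose (pathstart g) (pathstart h))"
    using link False lift_start[OF g] by (auto simp: linked_def attained_def x_def)
  let ?l = "reversepath \<delta> +++ \<gamma> +++ \<delta>"
  have "base_loop p x' ?l"
    using \<gamma>(1) lift_path[OF g] lift_path_image[OF g]
    by (auto simp: base_loop_def path_image_join x_def x'_def)
  moreover have "induced_by p x' ?l (Transposition.transpose (pathfinish g) (pathfinish h))"
    unfolding induced_by_def
  proof
    fix z assume z: "z \<in> fibre p x'"
    obtain k' where k': "is_lift p (reversepath \<delta>) k'" "pathstart k' = z"
      using lift_exists[of "reversepath \<delta>" z] lift_path[OF g] lift_path_image[OF g] z
      by (auto simp: fibre_def x'_def)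
    define k where "k = reversepath k'"
    have k: "is_lift p \<delta> k" "pathfinish k = z" using lift_reverse[OF k'(1)] k' by (simp_all add: k_def)
    have "pathstart k \<in> fibre p x" using lift_start[OF k(1)] by (simp add: fibre_def x_def)
    then obtain l where l: "is_lift p \<gamma> l" "pathstart l = pathstart k"
      "pathfinish l = Transposition.transpose (pathstart g) (pathstart h) (pathstart k)"
      using \<gamma>(2) unfolding induced_by_def by blast
    obtain q where q: "is_lift p \<delta> q" "pathstart q = Transposition.transpose (pathstart g) (pathstart h) (pathstart k)"
      "pathfinish q = Transposition.transpose (pathfinish g) (pathfinish h) z"
    proof -
      \<comment> \<open>By uniqueness of lifts, \<open>k\<close> starts where \<open>g\<close> or
        \<open>h\<close> starts exactly if it ends where that lift ends. So the continuation
        \<open>q\<close> is \<open>h\<close>, \<open>g\<close> or \<open>k\<close> itself.\<close>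
      note u = lift_unique_finish[OF k(1) g] lift_unique_finish[OF k(1) h]
      consider "pathstart k = pathstart g" | "pathstart k = pathstart h"
        | "pathstart k \<noteq> pathstart g" "pathstart k \<noteq> pathstart h" by blast
      then show ?thesis
      proof cases
        case 1 then show ?thesis using that[OF h] u k(2) by simp
      next
        case 2 then show ?thesis using that[OF g] u k(2) by simp
      next
        case 3 then show ?thesis using that[OF k(1)] u k(2) by (simp add: Transposition.transpose_def)
      qed
    qed
    show "\<exists>h'. is_lift p ?l h' \<and> pathstart h' = z \<and> pathfinish h' = Transposition.transpose (pathfinish g) (pathfinish h) z"
      using k' l q by (intro exI[of _ "k' +++ l +++ q"]) (simp add: lift_join k_def)
  qed
  ultimately show ?thesis
    using lift_finish[OF g] lift_finish[OF h] by (auto simp: linked_def attained_def x'_def)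
qed

lemma linked_transport_iff:
  assumes "is_lift p \<delta> g" "is_lift p \<delta> h"
  shows "linked (pathstart g) (pathstart h) \<longleftrightarrow> linked (pathfinish g) (pathfinish h)"
  using linked_transport[OF assms] linked_transport[OF assms[THEN lift_reverse]] by auto

section \<open>The classes of linked points and their local behaviour\<close>

definition link_class :: "complex \<Rightarrow> complex set" where
  "link_class y = {z. linked y z}"

lemma link_class_subset: "link_class y \<subseteq> fibre p (poly p y)"
  by (auto simp: link_class_def linked_def fibre_def)

lemma finite_link_class: "finite (link_class y)"
  using link_class_subset finite_fibre by (rule finite_subset)

lemma link_class_eq: "linked y z \<Longrightarrow> link_class y = link_class z"
  unfolding link_class_def by (intro Collect_cong) (metis linked_trans linked_sym)

text \<open>Over a disc of regular values the classes move with the branches: the branches lift the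
  straight segment from the centre to \<open>w\<close>, and lifting preserves linkedness in both
  directions. Composing the branch through \<open>k\<close> with \<open>p\<close> makes it a
  function of the point \<open>y\<close> upstairs.\<close>

lemma link_class_local:
  assumes y0: "y0 \<in> regular_points"
  shows "\<exists>N f. open N \<and> y0 \<in> N \<and> N \<subseteq> regular_points \<and> (\<forall>k\<in>link_class y0. f k holomorphic_on N) \<and>
    (\<forall>y\<in>N. bij_betw (\<lambda>k. f k y) (link_class y0) (link_class y))"
proof -
  define x where "x = poly p y0"
  have x: "x \<notin> critical_values p" using y0 by (simp add: x_def)
  obtain r s where r: "r > 0" "ball x r \<subseteq> - critical_values p"
    and s0: "\<forall>y\<in>fibre p x. s y holomorphic_on ball x r \<and> s y x = y \<and> (\<forall>w\<in>ball x r. poly p (s y w) = w)"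
    and bij: "\<forall>w\<in>ball x r. bij_betw (\<lambda>y. s y w) (fibre p x) (fibre p w)"
    using evenly_covered[OF x] by blast
  have s: "s y holomorphic_on ball x r" "s y x = y" "w \<in> ball x r \<Longrightarrow> poly p (s y w) = w"
    if "y \<in> fibre p x" for y w
    using s0 that by blast+
  have y0x: "y0 \<in> fibre p x" by (simp add: fibre_def x_def)
  have sub: "link_class y0 \<subseteq> fibre p x" using link_class_subset[of y0] by (simp add: x_def)
  have transport: "linked y k \<longleftrightarrow> linked (s y w) (s k w)"
    if "y \<in> fibre p x" "k \<in> fibre p x" "w \<in> ball x r" for y k w
  proof -
    have seg: "path_image (linepath x w) \<subseteq> ball x r"
      using that(3) r(1) by (simp add: closed_segment_subset)
    have "is_lift p (linepath x w) (s y \<circ> linepath x w)" if y: "y \<in> fibre p x" for y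
      unfolding is_lift_def
    proof (intro conjI ballI)
      show "path (s y \<circ> linepath x w)"
        using s(1)[OF y] seg by (intro path_continuous_image) (auto intro: continuous_on_subset holomorphic_on_imp_continuous_on)
      have "path_image (s y \<circ> linepath x w) \<subseteq> s y ` ball x r"
        unfolding path_image_compose using seg by blast
      then show "path_image (s y \<circ> linepath x w) \<subseteq> regular_points"
        using s(3)[OF y] r(2) by fastforce
      fix t :: real assume "t \<in> {0..1}"
      then have "linepath x w t \<in> ball x r" using seg unfolding path_image_def by blast
      then show "poly p ((s y \<circ> linepath x w) t) = linepath x w t" using s(3)[OF y] by simp
    qed
    from linked_transport_iff[OF this this, OF that(1,2)] show ?thesis
      using s(2) that by (simp add: pathstart_compose pathfinish_compose)
  qed
  \<comment> \<open>The sheet through \<open>y0\<close>: there \<open>y\<close> is the value of the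
    branch through \<open>y0\<close>, so its class comes from the class of
    \<open>y0\<close>.\<close>
  define N where "N = s y0 ` ball x r"
  have inj: "inj_on (s y0) (ball x r)" using s(3)[OF y0x] by (metis inj_onI)
  have pN: "poly p y \<in> ball x r" "y = s y0 (poly p y)" if "y \<in> N" for y
    using that s(3)[OF y0x] unfolding N_def by auto
  have "open N" unfolding N_def by (rule open_mapping_thm3[OF s(1)[OF y0x] open_ball inj])
  moreover have "y0 \<in> N" unfolding N_def using s(2)[OF y0x] r(1) by (metis centre_in_ball image_eqI)
  moreover have "N \<subseteq> regular_points" using pN(1) r(2) by blast
  moreover have "(\<lambda>y. s k (poly p y)) holomorphic_on N" if "k \<in> link_class y0" for k
  proof -
    have "(s k \<circ> poly p) holomorphic_on N"
      using sub that s(1) pN(1) by (intro holomorphic_on_compose_gen[of _ _ _ "ball x r"] holomorphic_intros) auto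
    then show ?thesis by (simp add: o_def)
  qed
  moreover have "bij_betw (\<lambda>k. s k (poly p y)) (link_class y0) (link_class y)" if y: "y \<in> N" for y
  proof -
    define w where "w = poly p y"
    have w: "w \<in> ball x r" "y = s y0 w" using pN[OF y] by (simp_all add: w_def)
    have b: "bij_betw (\<lambda>k. s k w) (fibre p x) (fibre p w)" using bij w(1) by blast
    have "(\<lambda>k. s k w) ` link_class y0 = link_class y"
    proof (intro equalityI subsetI)
      fix z assume "z \<in> (\<lambda>k. s k w) ` link_class y0"
      then obtain k where k: "k \<in> link_class y0" "z = s k w" by blast
      then show "z \<in> link_class y"
        using transport[OF y0x _ w(1), of k] sub w(2) by (auto simp: link_class_def)
    next
      fix z assume z: "z \<in> link_class y"
      then have "z \<in> fibre p w" using link_class_subset[of y] by (auto simp: w_def)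
      then obtain k where k: "k \<in> fibre p x" "z = s k w" using b by (auto simp: bij_betw_def)
      then have "linked y0 k" using transport[OF y0x k(1) w(1)] z w(2) by (auto simp: link_class_def)
      then show "z \<in> (\<lambda>k. s k w) ` link_class y0" using k by (auto simp: link_class_def)
    qed
    then show ?thesis
      using b sub unfolding w_def[symmetric] by (auto simp: bij_betw_def intro: inj_on_subset)
  qed
  ultimately show ?thesis
    by (intro exI[of _ N] exI[of _ "\<lambda>k y. s k (poly p y)"] conjI ballI)
qed

lemma card_link_class_const:
  assumes "y \<in> regular_points" "z \<in> regular_points"
  shows "card (link_class y) = card (link_class z)"
proof -
  have "(\<lambda>y. card (link_class y)) constant_on regular_points"
  proof (rule locally_constant_imp_constant)
    show "connected regular_points" using path_connected_regular_points by (rule path_connected_imp_connected)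
    fix y0 assume "y0 \<in> regular_points"
    from link_class_local[OF this] obtain N f where N: "open N" "y0 \<in> N" "N \<subseteq> regular_points"
      and b: "\<forall>y\<in>N. bij_betw (\<lambda>k. f k y) (link_class y0) (link_class y)" by blast
    have *: "card (link_class y) = card (link_class y0)" if "y \<in> N" for y
      using bij_betw_same_card[OF bspec[OF b that]] by (rule sym)
    have "openin (top_of_set regular_points) N"
      using N open_regular_points by (simp add: openin_open_eq)
    then show "\<exists>T. openin (top_of_set regular_points) T \<and> y0 \<in> T \<and> (\<forall>y\<in>T. card (link_class y) = card (link_class y0))"
      using N(2) * by blast
  qed
  then show ?thesis using assms by (auto simp: constant_on_def)
qed

text \<open>The product is symmetric in the class, so locally it can be computed from holomorphic
  branches, however the class is numbered.\<close>

lemma link_class_prod_holomorphic: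
  "(\<lambda>y. \<Prod>k\<in>link_class y. z - k) holomorphic_on regular_points"
proof -
  have "(\<lambda>y. \<Prod>k\<in>link_class y. z - k) field_differentiable at y0" if y0: "y0 \<in> regular_points" for y0
  proof -
    obtain N f where N: "open N" "y0 \<in> N" "\<forall>k\<in>link_class y0. f k holomorphic_on N"
      and b: "\<forall>y\<in>N. bij_betw (\<lambda>k. f k y) (link_class y0) (link_class y)"
      using link_class_local[OF y0] by blast
    have "(\<lambda>y. \<Prod>k\<in>link_class y0. z - f k y) holomorphic_on N"
      using N(3) by (intro holomorphic_intros) auto
    then have "(\<lambda>y. \<Prod>k\<in>link_class y. z - k) holomorphic_on N"
    proof (rule holomorphic_transform)
      fix y assume "y \<in> N"
      then show "(\<Prod>k\<in>link_class y0. z - f k y) = (\<Prod>k\<in>link_class y. z - k)"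
        using b by (intro prod.reindex_bij_betw) blast
    qed
    then show ?thesis using N(1,2) by (rule holomorphic_on_imp_differentiable_at)
  qed
  then show ?thesis by (simp add: holomorphic_on_open[OF open_regular_points] field_differentiable_def)
qed

end

subsection \<open>Decomposition and local normal form\<close>

text \<open>Descent on the degree: \<open>P - P(c0)\<close> vanishes on the \<open>degree g\<close>
  points of the fibre of \<open>g\<close> through \<open>c0\<close>, so \<open>g - g(c0)\<close>
  divides it. The quotient is again constant on the fibres of \<open>g\<close> through the remaining
  points of \<open>C\<close>, of which infinitely many are left.\<close>

lemma pcompose_factor:
  fixes g P :: "complex poly"
  assumes g: "degree g > 0"
    and "infinite C" "\<And>c. c \<in> C \<Longrightarrow> card {y. poly g y = poly g c} = degree g"
    and "\<And>c y. c \<in> C \<Longrightarrow> poly g y = poly g c \<Longrightarrow> poly P y = poly P c"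
  shows "\<exists>h. P = pcompose h g"
  using assms(2-)
proof (induction "degree P" arbitrary: P C rule: less_induct)
  case less
  show ?case
  proof (cases "degree P = 0")
    case True
    then obtain a where "P = [:a:]" by (rule degree_eq_zeroE)
    then show ?thesis by (intro exI[of _ "[:a:]"]) simp
  next
    case False
    obtain c0 where c0: "c0 \<in> C" using less.prems(1) by (metis finite.emptyI ex_in_conv)
    define G where "G = g - [:poly g c0:]"
    define P' where "P' = P - [:poly P c0:]"
    have degG: "degree G = degree g"
      unfolding G_def diff_conv_add_uminus using g by (intro degree_add_eq_left) simp
    have degP': "degree P' = degree P"
      unfolding P'_def diff_conv_add_uminus using False by (intro degree_add_eq_left) simp
    have "G \<noteq> 0" using degG g by auto
    have polyG: "poly G y = poly g y - poly g c0" for y by (simp add: G_def)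
    have polyP': "poly P' y = poly P y - poly P c0" for y by (simp add: P'_def)
    have "P' mod G = 0"
    proof (rule ccontr)
      assume nz: "P' mod G \<noteq> 0"
      have "poly (P' mod G) y = 0" if "poly g y = poly g c0" for y
      proof -
        have "poly P' y = poly (P' div G) y * poly G y + poly (P' mod G) y"
          by (simp only: poly_add[symmetric] poly_mult[symmetric] div_mult_mod_eq)
        moreover have "poly P' y = 0" "poly G y = 0"
          using that less.prems(3)[OF c0 that] by (simp_all add: polyG polyP')
        ultimately show ?thesis by simp
      qed
      then have "card {y. poly g y = poly g c0} \<le> card {y. poly (P' mod G) y = 0}"
        using poly_roots_finite[OF nz] by (intro card_mono) auto
      also have "\<dots> \<le> degree (P' mod G)" using nz by (rule card_poly_roots_bound)
      also have "\<dots> < degree G" using degree_mod_less[OF \<open>G \<noteq> 0\<close>, of P'] nz by simp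
      finally show False using less.prems(2)[OF c0] degG by simp
    qed
    then obtain Q where Q: "P' = G * Q" by (metis mod_eq_0_iff_dvd dvdE)
    have "Q \<noteq> 0" using Q degP' False by auto
    then have "degree P = degree g + degree Q"
      using degree_mult_eq[OF \<open>G \<noteq> 0\<close>, of Q] degP' degG unfolding Q by simp
    then have lt: "degree Q < degree P" using g by simp
    \<comment> \<open>At the zeros of \<open>G\<close> the equation \<open>P' = G * Q\<close> gives
      no information on \<open>Q\<close>.\<close>
    define C' where "C' = C - {y. poly G y = 0}"
    have inf: "infinite C'" unfolding C'_def using less.prems(1) poly_roots_finite[OF \<open>G \<noteq> 0\<close>] by (rule Diff_infinite_finite[rotated])
    have const: "poly Q y = poly Q c" if c: "c \<in> C'" and eq: "poly g y = poly g c" for c y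
    proof -
      have "poly P y = poly P c" using less.prems(3)[OF _ eq] c by (simp add: C'_def)
      then have "poly (G * Q) y = poly (G * Q) c" by (simp add: polyP' flip: Q)
      moreover have "poly G y = poly G c" "poly G c \<noteq> 0" using eq c by (auto simp: polyG C'_def)
      ultimately show ?thesis by simp
    qed
    have card: "card {y. poly g y = poly g c} = degree g" if "c \<in> C'" for c
      using that less.prems(2) by (simp add: C'_def)
    obtain h where h: "Q = pcompose h g"
      using less.hyps[OF lt inf card const] by blast
    have "P = [:poly P c0:] + G * Q" by (simp add: P'_def flip: Q)
    also have "\<dots> = pcompose ([:poly P c0:] + [:- poly g c0, 1:] * h) g"
    proof -
      have "pcompose [:- poly g c0, 1:] g = G" by (simp add: pcompose_pCons G_def)
      then show ?thesis by (simp only: pcompose_add pcompose_mult pcompose_const h)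
    qed
    finally show ?thesis by blast
  qed
qed

text \<open>At a double zero, \<open>p - p(c)\<close> is the square of \<open>(w - c) g(w)\<close>
  with \<open>g(c) \<noteq> 0\<close>. This square root has derivative \<open>g(c)\<close> at
  \<open>c\<close>, hence a local inverse \<psi>, and its value \<open>u\<close> is a coordinate in
  which \<open>p\<close> is exactly \<open>p(c) + u^2\<close>.\<close>

lemma double_root_branch:
  fixes p :: "complex poly"
  assumes c: "poly (pderiv p) c = 0" "poly (pderiv (pderiv p)) c \<noteq> 0" and e: "e > 0"
  shows "\<exists>r>0. \<exists>\<psi>. continuous_on (ball 0 r) \<psi> \<and> inj_on \<psi> (ball 0 r) \<and> \<psi> ` ball 0 r \<subseteq> ball c e \<and>
    (\<forall>u\<in>ball 0 r. poly p (\<psi> u) = poly p c + u\<^sup>2)"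
proof -
  have hol: "poly p holomorphic_on UNIV" by (intro holomorphic_intros)
  have der: "deriv (poly q) = poly (pderiv q)" for q :: "complex poly"
    by (intro ext DERIV_imp_deriv poly_DERIV)
  have d2: "(deriv ^^ 2) (poly p) c \<noteq> 0" 
    unfolding numeral_2_eq_2 using c(2) by (simp only: funpow.simps o_apply id_apply der simp_thms)
  have d1: "(deriv ^^ i) (poly p) c = 0" if "0 < i" "i < 2" for i
  proof -
    have "i = 1" using that by simp
    then show ?thesis using c(1) by (simp add: der)
  qed
  obtain g r where r: "0 < r" and g: "g holomorphic_on ball c r"
    and eq: "\<And>w. w \<in> ball c r \<Longrightarrow> poly p w - poly p c = ((w - c) * g w)\<^sup>2"
    and nz: "\<And>w. w \<in> ball c r \<Longrightarrow> g w \<noteq> 0"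
  proof (rule holomorphic_factor_order_of_zero_strong[OF hol open_UNIV UNIV_I zero_less_numeral d2 d1])
    fix g r assume "0 < r" "g holomorphic_on ball c r"
      "\<And>w. w \<in> ball c r \<Longrightarrow> poly p w - poly p c = ((w - c) * g w)\<^sup>2"
      "\<And>w. w \<in> ball c r \<Longrightarrow> g w \<noteq> 0"
    then show thesis by (rule that)
  qed
  define \<phi> where "\<phi> = (\<lambda>w. (w - c) * g w)"
  define r' where "r' = min r e"
  have r': "r' > 0" "ball c r' \<subseteq> ball c r" "ball c r' \<subseteq> ball c e"
    using r e by (auto simp: r'_def)
  have hol': "\<phi> holomorphic_on ball c r'"
    unfolding \<phi>_def using g r'(2) by (intro holomorphic_intros) (rule holomorphic_on_subset)
  have "(g has_field_derivative deriv g c) (at c)"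
    using g r by (intro holomorphic_derivI[of _ "ball c r"]) auto
  then have "(\<phi> has_field_derivative g c) (at c)"
    unfolding \<phi>_def by (auto intro!: derivative_eq_intros)
  then have "deriv \<phi> c \<noteq> 0" using nz[of c] r by (simp add: DERIV_imp_deriv)
  from has_complex_derivative_locally_invertible[OF hol' _ open_ball this]
  obtain q where q: "q > 0" "ball c q \<subseteq> ball c r'" "open (\<phi> ` ball c q)" "inj_on \<phi> (ball c q)"
    using r'(1) by auto
  obtain \<psi> where \<psi>: "\<psi> holomorphic_on \<phi> ` ball c q" "\<And>z. z \<in> ball c q \<Longrightarrow> \<psi> (\<phi> z) = z"
    using holomorphic_has_inverse[OF holomorphic_on_subset[OF hol' q(2)] open_ball q(4)] by metis
  have "\<phi> c \<in> \<phi> ` ball c q" using q(1) by simp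
  then have "0 \<in> \<phi> ` ball c q" by (simp add: \<phi>_def)
  then obtain \<rho> where \<rho>: "\<rho> > 0" "ball 0 \<rho> \<subseteq> \<phi> ` ball c q" using q(3) by (meson openE)
  have inv: "\<psi> u \<in> ball c q \<and> \<phi> (\<psi> u) = u" if u: "u \<in> ball 0 \<rho>" for u
  proof -
    obtain z where "z \<in> ball c q" "u = \<phi> z" using subsetD[OF \<rho>(2) u] by blast
    then show ?thesis using \<psi>(2) by simp
  qed
  show ?thesis
  proof (intro exI conjI ballI)
    show "\<rho> > 0" by fact
    show "continuous_on (ball 0 \<rho>) \<psi>"
      using holomorphic_on_subset[OF \<psi>(1) \<rho>(2)] by (rule holomorphic_on_imp_continuous_on)
    show "inj_on \<psi> (ball 0 \<rho>)" using inv by (intro inj_on_inverseI[where g = \<phi>]) blast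
    show "\<psi> ` ball 0 \<rho> \<subseteq> ball c e" using inv q(2) r'(3) by blast
    fix u :: complex assume u: "u \<in> ball 0 \<rho>"
    have "\<psi> u \<in> ball c r" using inv[OF u] q(2) r'(2) by blast
    from eq[OF this] have "poly p (\<psi> u) - poly p c = (\<phi> (\<psi> u))\<^sup>2" by (simp add: \<phi>_def)
    then show "poly p (\<psi> u) = poly p c + u\<^sup>2" using inv[OF u] by (simp add: algebra_simps)
  qed
qed

text \<open>Differentiating \<open>(y - c)^2 R(y)\<close> twice gives
  \<open>p''(c) = 2 R(c)\<close>.\<close>

lemma nondegenerate_factor:
  fixes p :: "'a::{idom,ring_char_0} poly"
  assumes "poly p c = 0" "poly (pderiv p) c = 0" "poly (pderiv (pderiv p)) c \<noteq> 0"
  obtains R where "p = [:- c, 1:] * ([:- c, 1:] * R)" "poly R c \<noteq> 0"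
proof -
  obtain Q where Q: "p = [:- c, 1:] * Q" using assms(1) by (auto simp: poly_eq_0_iff_dvd)
  then have "poly Q c = 0" using assms(2) poly_pderiv_linear_factor[of c Q] by simp
  then obtain R where R: "Q = [:- c, 1:] * R" by (auto simp: poly_eq_0_iff_dvd)
  have "pderiv p = Q + [:- c, 1:] * pderiv Q"
    unfolding Q pderiv_mult by (simp add: pderiv_pCons)
  then have "poly (pderiv (pderiv p)) c = 2 * poly (pderiv Q) c"
    using poly_pderiv_linear_factor[of c "pderiv Q"] by (simp only: pderiv_add poly_add mult_2)
  also have "poly (pderiv Q) c = poly R c" unfolding R by (rule poly_pderiv_linear_factor)
  finally have "poly R c \<noteq> 0" using assms(3) by auto
  with Q R show ?thesis by (intro that[of R]) simp_all
qed

context nonconst_poly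
begin

text \<open>A small circle around a simple critical value lifts to a transposition of the two preimages
  close to the critical point; the other branches extend over the disc and are fixed.\<close>

lemma ex_linked:
  assumes c: "c \<in> critical_points p" "nondegenerate p c"
    and inj: "inj_on (poly p) (critical_points p)"
  shows "\<exists>y z. y \<in> regular_points \<and> y \<noteq> z \<and> linked y z"
proof -
  define b where "b = poly p c"
  define F where "F = fibre p b - {c}"
  have crit_eq: "y = c" if "poly p y = b" "poly (pderiv p) y = 0" for y
    using inj_onD[OF inj, of y c] that c(1) by (simp add: critical_points_def b_def)
  have c': "poly (pderiv p) c = 0" "poly (pderiv (pderiv p)) c \<noteq> 0"
    using c by (simp_all add: critical_points_def nondegenerate_def)
  have finF: "finite F" unfolding F_def by (intro finite_Diff finite_fibre)
  \<comment> \<open>By injectivity on critical points, \<open>c\<close> is the only multiple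
    preimage of \<open>b\<close>, and its multiplicity is 2. This count shows later that the
    branches through \<open>F\<close> and the two points near \<open>c\<close> exhaust the fibre
    over \<open>x\<close>.\<close>
  have cardF: "card F + 2 = degree p"
  proof -
    have pd: "pderiv (p - [:b:]) = pderiv p" by (simp add: pderiv_diff pderiv_pCons)
    obtain R where R: "p - [:b:] = [:- c, 1:] * ([:- c, 1:] * R)" "poly R c \<noteq> 0"
    proof (rule nondegenerate_factor[of "p - [:b:]" c])
      show "poly (p - [:b:]) c = 0" by (simp add: b_def)
    qed (use c' pd in auto)
    have eval: "poly p y - b = (y - c)\<^sup>2 * poly R y" for y
    proof -
      have "poly (p - [:b:]) y = poly ([:- c, 1:] * ([:- c, 1:] * R)) y" by (simp only: R(1))
      then show ?thesis by (simp add: power2_eq_square algebra_simps)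
    qed
    have Fr: "F = {y. poly R y = 0}"
    proof (intro equalityI subsetI)
      fix y assume "y \<in> F"
      then have "poly p y = b" "y \<noteq> c" by (auto simp: F_def fibre_def)
      then show "y \<in> {y. poly R y = 0}" using eval[of y] by simp
    next
      fix y assume "y \<in> {y. poly R y = 0}"
      then have "poly R y = 0" by simp
      then show "y \<in> F" using eval[of y] R(2) by (auto simp: F_def fibre_def)
    qed
    have "rsquarefree R"
      unfolding rsquarefree_roots
    proof (intro allI notI)
      fix y assume y: "poly R y = 0 \<and> poly (pderiv R) y = 0"
      have "poly (pderiv (p - [:b:])) y = 0"
        unfolding R(1) pderiv_mult using y by simp
      moreover have "poly p y = b" using eval[of y] y by simp
      ultimately have "y = c" using crit_eq pd by simp
      then show False using y R(2) by simp
    qed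
    then have "card F = degree R" unfolding Fr by (rule card_roots_rsquarefree)
    moreover have "degree (p - [:b:]) = degree R + 2"
    proof -
      have "R \<noteq> 0" using R(2) by auto
      then show ?thesis unfolding R(1) by (simp add: degree_mult_eq del: mult_pCons_left mult_pCons_right)
    qed
    ultimately show ?thesis using degree_diff_const[of b] by simp
  qed
  obtain e where e: "e > 0" "\<And>y z. y \<in> fibre p b \<Longrightarrow> z \<in> fibre p b \<Longrightarrow> y \<noteq> z \<Longrightarrow> ball y e \<inter> ball z e = {}"
    using finite_separation[OF finite_fibre] by meson
  have rootF: "poly p y = b \<and> poly (pderiv p) y \<noteq> 0" if "y \<in> F" for y
    using that crit_eq by (auto simp: F_def fibre_def)
  from simple_roots_branches[OF finF rootF e(1)] obtain r s where r: "r > 0"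
    and s0: "\<forall>y\<in>F. s y holomorphic_on ball b r \<and> s y b = y \<and> s y ` ball b r \<subseteq> ball y e \<and>
      (\<forall>w\<in>ball b r. poly p (s y w) = w)" by blast
  have s: "continuous_on (ball b r) (s y)" "s y ` ball b r \<subseteq> ball y e" "w \<in> ball b r \<Longrightarrow> poly p (s y w) = w"
    if "y \<in> F" for y w
    using s0 that holomorphic_on_imp_continuous_on by blast+
  from double_root_branch[OF c' e(1)] obtain \<rho> \<psi> where \<rho>: "\<rho> > 0"
    and cont: "continuous_on (ball 0 \<rho>) \<psi>" and inj\<psi>: "inj_on \<psi> (ball 0 \<rho>)"
    and \<psi>: "\<psi> ` ball 0 \<rho> \<subseteq> ball c e" "\<forall>u\<in>ball 0 \<rho>. poly p (\<psi> u) = b + u\<^sup>2"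
    unfolding b_def by blast
  have "open (- (critical_values p - {b}))"
    using finite_critical_values by (intro open_Compl finite_imp_closed) simp
  then obtain t where t: "t > 0" "ball b t \<subseteq> - (critical_values p - {b})"
    by (rule openE[of _ b]) auto
  \<comment> \<open>The lifts near \<open>c\<close> run on a circle of radius \<epsilon> in the
    coordinate \<open>u\<close>, the loop itself on one of radius \<epsilon> squared around
    \<open>b\<close>. So \<epsilon> is compared with \<rho>, and its square with \<open>r\<close>
    (domain of the other branches) and \<open>t\<close> (distance to other critical values). The
    bound by 1 gives \<open>\<epsilon>\<^sup>2 \<le> \<epsilon>\<close>.\<close>
  obtain \<epsilon> where \<epsilon>: "\<epsilon> > 0" "\<epsilon> < \<rho>" "\<epsilon>\<^sup>2 < r" "\<epsilon>\<^sup>2 < t"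
  proof -
    define \<epsilon> where "\<epsilon> = min (min \<rho> 1) (min r t) / 2"
    have pos: "0 < \<epsilon>" "\<epsilon> < \<rho>" "\<epsilon> < r" "\<epsilon> < t" "\<epsilon> < 1" using \<rho> r t by (auto simp: \<epsilon>_def)
    have "\<epsilon>\<^sup>2 \<le> \<epsilon>" using pos by (simp add: power2_eq_square mult_left_le)
    then show ?thesis using pos that by auto
  qed
  \<comment> \<open>A half turn of \<open>u\<close> is a full turn of \<open>u^2\<close>: the loop
    closes while \<open>u\<close> passes from \<epsilon> to -\<epsilon> or back, which exchanges the
    two preimages.\<close>
  define \<gamma> where "\<gamma> = (\<lambda>\<tau>::real. b + (of_real \<epsilon> * exp (of_real (pi * \<tau>) * \<i>))\<^sup>2)"
  have \<gamma>path: "path \<gamma>" unfolding path_def \<gamma>_def by (intro continuous_intros)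
  have \<gamma>dist: "dist b (\<gamma> \<tau>) = \<epsilon>\<^sup>2" for \<tau>
    by (simp add: \<gamma>_def dist_norm norm_mult norm_power norm_exp_eq_Re power_mult_distrib)
  have \<gamma>r: "\<gamma> \<tau> \<in> ball b r" for \<tau> using \<gamma>dist \<epsilon> by simp
  have \<gamma>reg: "\<gamma> \<tau> \<in> - critical_values p" for \<tau>
  proof -
    have "\<gamma> \<tau> \<noteq> b" using \<gamma>dist[of \<tau>] \<epsilon>(1) by auto
    moreover have "\<gamma> \<tau> \<in> ball b t" using \<gamma>dist \<epsilon> by simp
    ultimately show ?thesis using t(2) by blast
  qed
  define x where "x = \<gamma> 0"
  have \<gamma>1: "\<gamma> 1 = x" by (simp add: \<gamma>_def x_def)
  have loop: "base_loop p x \<gamma>"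
    using \<gamma>path \<gamma>reg \<gamma>1 by (auto simp: base_loop_def path_image_def pathstart_def pathfinish_def x_def)
  have lift\<psi>: "is_lift p \<gamma> (\<lambda>\<tau>. \<psi> (\<sigma> * (of_real \<epsilon> * exp (of_real (pi * \<tau>) * \<i>))))"
    if \<sigma>: "\<sigma> = 1 \<or> \<sigma> = - 1" for \<sigma> :: complex
  proof -
    let ?u = "\<lambda>\<tau>::real. \<sigma> * (of_real \<epsilon> * exp (of_real (pi * \<tau>) * \<i>))"
    have u: "?u \<tau> \<in> ball 0 \<rho>" for \<tau>
      using \<sigma> \<epsilon> by (auto simp: norm_mult norm_exp_eq_Re)
    have val: "poly p (\<psi> (?u \<tau>)) = \<gamma> \<tau>" for \<tau>
      using \<psi>(2) u[of \<tau>] \<sigma> by (auto simp: \<gamma>_def)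
    have "path (\<lambda>\<tau>. \<psi> (?u \<tau>))"
      unfolding path_def by (rule continuous_on_compose2[OF cont]) (use u in \<open>auto intro!: continuous_intros\<close>)
    moreover have "path_image (\<lambda>\<tau>. \<psi> (?u \<tau>)) \<subseteq> regular_points"
      using val \<gamma>reg by (auto simp: path_image_def)
    ultimately show ?thesis using val by (simp add: is_lift_def)
  qed
  have lifts: "is_lift p \<gamma> (s y \<circ> \<gamma>)" if y: "y \<in> F" for y
  proof -
    have "path_image \<gamma> \<subseteq> ball b r" using \<gamma>r unfolding path_image_def by blast
    then have "path (s y \<circ> \<gamma>)"
      by (intro path_continuous_image[OF \<gamma>path] continuous_on_subset[OF s(1)[OF y]])
    moreover have "path_image (s y \<circ> \<gamma>) \<subseteq> regular_points"
      using s(3)[OF y] \<gamma>r \<gamma>reg by (auto simp: path_image_def)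
    ultimately show ?thesis using s(3)[OF y] \<gamma>r by (simp add: is_lift_def)
  qed
  define y1 where "y1 = \<psi> (of_real \<epsilon>)"
  define y2 where "y2 = \<psi> (- of_real \<epsilon>)"
  have u: "of_real \<epsilon> \<in> ball (0::complex) \<rho>" "- of_real \<epsilon> \<in> ball (0::complex) \<rho>" using \<epsilon> by auto
  have y12: "y1 \<noteq> y2" unfolding y1_def y2_def using inj_onD[OF inj\<psi> _ u] \<epsilon>(1) by auto
  have x_eq: "x = b + (of_real \<epsilon>)\<^sup>2" by (simp add: x_def \<gamma>_def)
  have p12: "poly p y1 = x" "poly p y2 = x" using \<psi>(2) u by (auto simp: y1_def y2_def x_eq)
  have ball12: "y1 \<in> ball c e" "y2 \<in> ball c e" unfolding y1_def y2_def using \<psi>(1) u by blast+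
  have xr: "x \<in> ball b r" using \<gamma>r by (simp add: x_def)
  have sx: "s y x \<in> ball y e" "poly p (s y x) = x" if "y \<in> F" for y
    using s(2,3)[OF that] xr by blast+
  have cfib: "c \<in> fibre p b" by (simp add: fibre_def b_def)
  have injs: "inj_on (\<lambda>y. s y x) F"
  proof (rule inj_onI)
    fix y z assume yz: "y \<in> F" "z \<in> F" "s y x = s z x"
    then have "ball y e \<inter> ball z e \<noteq> {}" using sx(1)[of y] sx(1)[of z] by auto
    then show "y = z" using e(2)[of y z] yz by (auto simp: F_def)
  qed
  have notin: "s y x \<noteq> y1" "s y x \<noteq> y2" if "y \<in> F" for y
    using e(2)[of y c] that cfib sx(1)[OF that] ball12 by (auto simp: F_def)
  have fib: "fibre p x = insert y1 (insert y2 ((\<lambda>y. s y x) ` F))"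
  proof (rule card_subset_eq[OF finite_fibre, symmetric])
    show "insert y1 (insert y2 ((\<lambda>y. s y x) ` F)) \<subseteq> fibre p x"
      using p12 sx(2) by (auto simp: fibre_def)
    have "card (insert y1 (insert y2 ((\<lambda>y. s y x) ` F))) = card F + 2"
      using y12 notin finF card_image[OF injs] by (auto simp: card_insert_if image_iff)
    moreover have "card (fibre p x) = degree p" using \<gamma>reg[of 0] by (intro card_fibre) (simp add: x_def)
    ultimately show "card (insert y1 (insert y2 ((\<lambda>y. s y x) ` F))) = card (fibre p x)" using cardF by simp
  qed
  have "induced_by p x \<gamma> (Transposition.transpose y1 y2)"
    unfolding induced_by_def
  proof
    fix z assume "z \<in> fibre p x"
    then consider "z = y1" | "z = y2" | y where "y \<in> F" "z = s y x" using fib by auto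
    then show "\<exists>g. is_lift p \<gamma> g \<and> pathstart g = z \<and> pathfinish g = Transposition.transpose y1 y2 z"
    proof cases
      case 1
      then show ?thesis
        by (intro exI[of _ "\<lambda>\<tau>. \<psi> (1 * (of_real \<epsilon> * exp (of_real (pi * \<tau>) * \<i>)))"] conjI lift\<psi>)
          (simp_all add: pathstart_def pathfinish_def y1_def y2_def)
    next
      case 2
      then show ?thesis
        by (intro exI[of _ "\<lambda>\<tau>. \<psi> (- 1 * (of_real \<epsilon> * exp (of_real (pi * \<tau>) * \<i>)))"] conjI lift\<psi>)
          (simp_all add: pathstart_def pathfinish_def y1_def y2_def)
    next
      case 3
      then show ?thesis using lifts[of y] notin[of y] \<gamma>1
        by (intro exI[of _ "s y \<circ> \<gamma>"]) (simp add: pathstart_def pathfinish_def x_def)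
    qed
  qed
  then have "linked y1 y2" using loop p12 by (auto simp: linked_def attained_def)
  moreover have "y1 \<in> regular_points" using p12 \<gamma>reg[of 0] by (simp add: x_def)
  ultimately show ?thesis using y12 by blast
qed

text \<open>Let \<open>S\<close> be the sum of the norms of the lower coefficients and
  \<open>M = max 1 (norm y)\<close>. If \<open>norm z > M\<close>, comparing leading terms in
  \<open>p(y) = p(z)\<close> and dividing by \<open>norm z ^ n\<close> leaves
  \<open>norm z \<le> M + 2 * S\<close>, which is at most \<open>(1 + 2 * S) * M\<close> as
  \<open>M \<ge> 1\<close>.\<close>

lemma preimage_growth:
  assumes monic: "lead_coeff p = 1"
  shows "\<exists>A\<ge>1. \<forall>y z. poly p y = poly p z \<longrightarrow> norm z \<le> A * max 1 (norm y)"
proof -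
  define n where "n = degree p - 1"
  have n: "degree p = Suc n" using deg by (simp add: n_def)
  define q where "q = (\<lambda>w. \<Sum>i\<le>n. coeff p i * w ^ i)"
  have p_eq: "poly p w = w ^ Suc n + q w" for w
    using monic by (simp add: poly_altdef n q_def)
  define S where "S = (\<Sum>i\<le>n. norm (coeff p i))"
  have S: "S \<ge> 0" by (simp add: S_def sum_nonneg)
  have q: "norm (q w) \<le> S * M ^ n" if "1 \<le> M" "norm w \<le> M" for w M
  proof -
    have "norm (q w) \<le> (\<Sum>i\<le>n. norm (coeff p i * w ^ i))" unfolding q_def by (rule norm_sum)
    also have "\<dots> \<le> (\<Sum>i\<le>n. norm (coeff p i) * M ^ n)"
    proof (rule sum_mono)
      fix i assume "i \<in> {..n}"
      then have "norm w ^ i \<le> M ^ n"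
        using that power_mono[of "norm w" M i] power_increasing[of i n M] by simp
      then show "norm (coeff p i * w ^ i) \<le> norm (coeff p i) * M ^ n"
        by (simp add: norm_mult norm_power mult_left_mono)
    qed
    finally show ?thesis by (simp add: S_def sum_distrib_right)
  qed
  have "norm z \<le> (1 + 2 * S) * max 1 (norm y)" if eq: "poly p y = poly p z" for y z
  proof (cases "norm z \<le> max 1 (norm y)")
    case True
    have "1 * max 1 (norm y) \<le> (1 + 2 * S) * max 1 (norm y)" using S by (intro mult_right_mono) auto
    with True show ?thesis by linarith
  next
    case False
    define M where "M = max 1 (norm y)"
    have M: "1 \<le> M" "norm y \<le> M" "M \<le> norm z" using False by (auto simp: M_def)
    have pow: "M ^ n \<le> norm z ^ n" using M by (intro power_mono) auto
    have "norm z ^ n * norm z = norm (y ^ Suc n + q y - q z)"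
      using eq p_eq[of y] p_eq[of z] by (simp add: norm_mult norm_power algebra_simps)
    also have "\<dots> \<le> norm (y ^ Suc n) + norm (q y) + norm (q z)"
      using norm_triangle_ineq4[of "y ^ Suc n + q y" "q z"] norm_triangle_ineq[of "y ^ Suc n" "q y"] by linarith
    also have "norm (y ^ Suc n) \<le> M * norm z ^ n"
    proof -
      have "norm y ^ n \<le> norm z ^ n" using power_mono[OF M(2), of n] pow by simp
      then show ?thesis using M by (simp add: norm_mult norm_power mult_mono)
    qed
    also have "norm (q y) \<le> S * norm z ^ n" using q[of M y] M mult_left_mono[OF pow S] by linarith
    also have "norm (q z) \<le> S * norm z ^ n" using q[of "norm z" z] M by auto
    finally have "norm z ^ n * norm z \<le> norm z ^ n * (M + 2 * S)" by (simp add: algebra_simps)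
    moreover have "0 < norm z ^ n" using M by (intro zero_less_power) linarith
    ultimately have "norm z \<le> M + 2 * S" by (simp add: mult_le_cancel_left_pos)
    also have "\<dots> \<le> (1 + 2 * S) * M" using M S mult_left_mono[of 1 M "2 * S"] by (simp add: algebra_simps)
    finally show ?thesis by (simp add: M_def)
  qed
  then show ?thesis using S by (intro exI[of _ "1 + 2 * S"]) auto
qed

text \<open>The product is single-valued in \<open>y\<close>, so it extends over the finitely many singular points,
  where it is bounded. As \<open>k = O(y)\<close> for \<open>k\<close> in the class of \<open>y\<close>, Liouville's theorem applies.\<close>

lemma link_class_prod_poly:
  assumes monic: "lead_coeff p = 1" and d: "\<And>y. y \<in> regular_points \<Longrightarrow> card (link_class y) = d"
  shows "\<exists>q. degree q \<le> d \<and> (\<forall>y\<in>regular_points. poly q y = (\<Prod>k\<in>link_class y. z - k))"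
proof -
  define E where "E = (\<lambda>y. \<Prod>k\<in>link_class y. z - k)"
  obtain A where A: "A \<ge> 1" "\<And>y k. poly p y = poly p k \<Longrightarrow> norm k \<le> A * max 1 (norm y)"
    using preimage_growth[OF monic] by blast
  define K where "K = norm z + A"
  have K: "K \<ge> 1" using A(1) by (simp add: K_def add_increasing)
  have bound: "norm (E y) \<le> (K * max 1 (norm y)) ^ card (link_class y)" for y
  proof -
    have "norm (z - k) \<le> K * max 1 (norm y)" if "k \<in> link_class y" for k
    proof -
      have "poly p y = poly p k" using that by (simp add: link_class_def linked_def)
      then have "norm (z - k) \<le> norm z * 1 + A * max 1 (norm y)"
        using A(2)[of y k] norm_triangle_ineq4[of z k] by simp
      also have "\<dots> \<le> norm z * max 1 (norm y) + A * max 1 (norm y)"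
        by (intro add_right_mono mult_left_mono) auto
      finally show ?thesis by (simp add: K_def distrib_right)
    qed
    then have "(\<Prod>k\<in>link_class y. norm (z - k)) \<le> (\<Prod>k\<in>link_class y. K * max 1 (norm y))"
      by (intro prod_mono) auto
    then show ?thesis by (simp add: E_def prod_norm[symmetric])
  qed
  have bigO: "E \<in> O[at c](\<lambda>_. 1)" for c
  proof (rule bigoI[of _ "(K * (1 + norm c)) ^ degree p"])
    have "norm (E y) \<le> (K * (1 + norm c)) ^ degree p" if "dist y c < 1" for y
    proof -
      have "norm y \<le> norm c + dist y c" unfolding dist_norm by (rule norm_triangle_sub)
      then have le: "max 1 (norm y) \<le> 1 + norm c" using that by auto
      \<comment> \<open>Points within distance 1 of \<open>c\<close> may be singular, and the size
        \<open>d\<close> is known at regular points only. The bound by \<open>degree p\<close> holds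
        everywhere; the exponent may be raised to it because the base is at least 1.\<close>
      have "card (link_class y) \<le> card {w. poly (p - [:poly p y:]) w = 0}"
        using link_class_subset finite_fibre unfolding fibre_roots[symmetric] by (intro card_mono)
      also have "\<dots> \<le> degree p"
        using card_poly_roots_bound[of "p - [:poly p y:]"] degree_diff_const[of "poly p y"] deg by fastforce
      finally have cl: "card (link_class y) \<le> degree p" .
      have one: "1 \<le> K * (1 + norm c)" using K mult_mono[of 1 K 1 "1 + norm c"] by simp
      have "norm (E y) \<le> (K * max 1 (norm y)) ^ card (link_class y)" by (rule bound)
      also have "\<dots> \<le> (K * (1 + norm c)) ^ card (link_class y)"
        using le K by (intro power_mono mult_left_mono) auto
      also have "\<dots> \<le> (K * (1 + norm c)) ^ degree p" using one cl by (rule power_increasing[rotated])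
      finally show ?thesis .
    qed
    then show "eventually (\<lambda>y. norm (E y) \<le> (K * (1 + norm c)) ^ degree p * norm (1::complex)) (at c)"
      unfolding eventually_at by (intro exI[of _ 1]) auto
  qed
  have "E holomorphic_on UNIV - (poly p -` critical_values p)"
    unfolding E_def using link_class_prod_holomorphic by (simp add: Compl_eq_Diff_UNIV)
  from removable_singularities[OF finite_singular_points _ this bigO]
  obtain g where g: "g holomorphic_on UNIV" "\<And>y. y \<in> regular_points \<Longrightarrow> g y = E y" by auto
  obtain R where R: "\<And>y. y \<in> poly p -` critical_values p \<Longrightarrow> norm y \<le> R"
    using finite_imp_bounded[OF finite_singular_points] unfolding bounded_iff by blast
  \<comment> \<open>The Taylor polynomial of \<open>g\<close> at 0, with which Liouville's theorem
    identifies \<open>g\<close>.\<close>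
  define q where "q = (\<Sum>k\<le>d. monom ((deriv ^^ k) g 0 / fact k) k)"
  have "g y = poly q y" for y
  proof -
    have "g y = (\<Sum>k\<le>d. (deriv ^^ k) g 0 / fact k * y ^ k)"
    proof (rule Liouville_polynomial[OF g(1)])
      \<comment> \<open>Beyond \<open>R\<close> every point is regular, and from 1 on
        \<open>max 1 (norm w)\<close> is \<open>norm w\<close>.\<close>
      fix w :: complex assume w: "max 1 (R + 1) \<le> norm w"
      then have "w \<in> regular_points" using R[of w] by auto
      then show "norm (g w) \<le> K ^ d * norm w ^ d"
        using bound[of w] g(2) d w by (simp add: power_mult_distrib)
    qed
    then show ?thesis by (simp add: q_def poly_sum poly_monom)
  qed
  moreover have "degree q \<le> d"
    unfolding q_def by (intro degree_sum_le) (auto intro: order_trans[OF degree_monom_le])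
  ultimately show ?thesis using g(2) by (intro exI[of _ q]) (simp add: E_def)
qed

text \<open>Otherwise the classes are the fibres of a polynomial \<open>q\<close>, and \<open>p = h \<circ> q\<close> with \<open>h\<close> and \<open>q\<close> of
  degree at least \<open>2\<close>. Over a zero of \<open>h'\<close> all points of the fibre of \<open>q\<close> are critical for \<open>p\<close> with the
  same value, so this fibre is a single point, at which \<open>q'\<close> vanishes too and hence \<open>p''\<close>.\<close>

lemma link_class_eq_fibre:
  assumes monic: "lead_coeff p = 1"
    and ex: "y1 \<in> regular_points" "y1 \<noteq> y2" "linked y1 y2"
    and nondeg: "\<And>c. c \<in> critical_points p \<Longrightarrow> nondegenerate p c"
    and inj: "inj_on (poly p) (critical_points p)"
    and y0: "y0 \<in> regular_points"
  shows "link_class y0 = fibre p (poly p y0)"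
proof (rule ccontr)
  assume neq: "link_class y0 \<noteq> fibre p (poly p y0)"
  define d where "d = card (link_class y0)"
  have d: "card (link_class y) = d" if "y \<in> regular_points" for y
    unfolding d_def using card_link_class_const[OF that y0] .
  have "card {y1, y2} \<le> card (link_class y1)"
    using ex by (intro card_mono finite_link_class) (auto simp: link_class_def)
  then have d2: "d \<ge> 2" using d ex by simp
  have "d < card (fibre p (poly p y0))"
    unfolding d_def using neq link_class_subset by (intro psubset_card_mono finite_fibre) auto
  then have dlt: "d < degree p" using y0 by (simp add: card_fibre)
  \<comment> \<open>With the parameter \<open>y0\<close>, the product vanishes at a regular point
    exactly if the point is in the class of \<open>y0\<close>. As there is a point \<open>y3\<close>
    of the fibre outside this class, \<open>q\<close> is not constant.\<close>
  obtain q where q: "degree q \<le> d" "\<And>y. y \<in> regular_points \<Longrightarrow> poly q y = (\<Prod>k\<in>link_class y. y0 - k)"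
    using link_class_prod_poly[OF monic d, of y0] by blast
  obtain y3 where y3: "y3 \<in> fibre p (poly p y0)" "y3 \<notin> link_class y0"
    using neq link_class_subset by blast
  have y3': "y3 \<in> regular_points" using y3(1) y0 by (auto simp: fibre_def)
  have zero: "poly q y0 = 0"
  proof -
    have "y0 \<in> link_class y0" by (simp add: link_class_def)
    then show ?thesis using q(2)[OF y0] finite_link_class[of y0] by auto
  qed
  have nonzero: "poly q y3 \<noteq> 0"
  proof -
    have "y0 - k \<noteq> 0" if "k \<in> link_class y3" for k
      using that y3(2) linked_sym[of y3 y0] by (auto simp: link_class_def)
    then show ?thesis using q(2)[OF y3'] finite_link_class[of y3] by simp
  qed
  \<comment> \<open>\<open>q\<close> is constant on the class of \<open>y\<close>, so
    \<open>q - q(y)\<close> has at least \<open>d\<close> zeros, and its degree is at most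
    \<open>d\<close>. Equality holds throughout, and the fibre of \<open>q\<close> is the
    class.\<close>
  have roots: "{w. poly q w = poly q y} = link_class y \<and> degree q = d" if y: "y \<in> regular_points" for y
  proof -
    have nz: "q - [:poly q y:] \<noteq> 0"
    proof
      assume "q - [:poly q y:] = 0"
      then have "poly (q - [:poly q y:]) w = 0" for w by (simp only: poly_0)
      from this[of y0] this[of y3] show False using zero nonzero by simp
    qed
    have fin: "finite {w. poly q w = poly q y}" using poly_roots_finite[OF nz] by simp
    have sub: "link_class y \<subseteq> {w. poly q w = poly q y}"
    proof
      fix w assume w: "w \<in> link_class y"
      then have link: "linked y w" by (simp add: link_class_def)
      then have "w \<in> regular_points" using y by (simp add: linked_def)
      then show "w \<in> {w. poly q w = poly q y}" using q(2) y link_class_eq[OF link] by simp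
    qed
    have "card {w. poly q w = poly q y} \<le> degree (q - [:poly q y:])"
      using card_poly_roots_bound[OF nz] by simp
    also have "\<dots> \<le> degree q" by (intro degree_diff_le) auto
    finally have "card {w. poly q w = poly q y} \<le> degree q" .
    moreover have "d \<le> card {w. poly q w = poly q y}" using card_mono[OF fin sub] d[OF y] by simp
    ultimately have "card (link_class y) = card {w. poly q w = poly q y}" "degree q = d"
      using q(1) d[OF y] by auto
    then show ?thesis using card_subset_eq[OF fin sub] by simp
  qed
  have degq: "degree q = d" using roots[OF y0] by simp
  have inf: "infinite regular_points"
    unfolding Compl_eq_Diff_UNIV by (intro Diff_infinite_finite finite_singular_points infinite_UNIV_char_0)
  have card: "card {y. poly q y = poly q c} = degree q" if "c \<in> regular_points" for c
    using roots[OF that] d[OF that] by simp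
  have const: "poly p y = poly p c" if "c \<in> regular_points" "poly q y = poly q c" for c y
  proof -
    have "y \<in> link_class c" using roots[OF that(1)] that(2) by blast
    then show ?thesis by (simp add: link_class_def linked_def)
  qed
  have "degree q > 0" using degq d2 by simp
  from pcompose_factor[OF this inf card const] obtain h where h: "p = pcompose h q" by blast
  have "degree p = degree h * d" unfolding degq[symmetric] by (subst h) (rule degree_pcompose)
  then have "degree h \<noteq> 0" "degree h \<noteq> 1" using dlt by auto
  then have "degree (pderiv h) \<noteq> 0" by (simp add: degree_pderiv)
  then obtain w where w: "poly (pderiv h) w = 0"
    using Fundamental_Theorem_Algebra.fundamental_theorem_of_algebra[of "pderiv h"] by (auto simp: constant_degree)
  have dp: "pderiv p = pcompose (pderiv h) q * pderiv q" by (subst h) (rule pderiv_pcompose)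
  have degqw: "degree (q - [:w:]) = d"
    unfolding degq[symmetric] diff_conv_add_uminus using degq d2 by (intro degree_add_eq_left) simp
  then obtain z0 where z0: "poly q z0 = w"
    using Fundamental_Theorem_Algebra.fundamental_theorem_of_algebra[of "q - [:w:]"] d2 by (auto simp: constant_degree)
  have uniq: "z = z0" if "poly q z = w" for z
  proof (rule inj_onD[OF inj])
    show "poly p z = poly p z0" by (subst (1 2) h) (simp add: poly_pcompose that z0)
  qed (simp_all add: critical_points_def dp poly_pcompose that z0 w)
  have "poly (pderiv q) z0 = 0"
  proof (rule ccontr)
    assume nz: "poly (pderiv q) z0 \<noteq> 0"
    have "rsquarefree (q - [:w:])"
      unfolding rsquarefree_roots
    proof (intro allI notI)
      fix y assume y: "poly (q - [:w:]) y = 0 \<and> poly (pderiv (q - [:w:])) y = 0"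
      then have "poly q y = w" "poly (pderiv q) y = 0" by (simp_all add: pderiv_diff pderiv_pCons)
      then show False using uniq nz by blast
    qed
    from card_roots_rsquarefree[OF this] have "card {z. poly q z = w} = d" using degqw by simp
    moreover have "{z. poly q z = w} = {z0}" using uniq z0 by blast
    ultimately show False using d2 by simp
  qed
  \<comment> \<open>\<open>p''\<close> is \<open>h''(q) q'^2 + h'(q) q''\<close>, and each summand
    contains a factor that vanishes at \<open>z0\<close>.\<close>
  then have "poly (pderiv (pderiv p)) z0 = 0"
    by (simp add: dp pderiv_mult pderiv_pcompose poly_pcompose z0 w)
  moreover have "z0 \<in> critical_points p" by (simp add: critical_points_def dp poly_pcompose z0 w)
  ultimately show False using nondeg by (auto simp: nondegenerate_def)
qed

text \<open>Permutations of a finite fibre are products of transpositions, and a fibre that is a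
  single class supplies all of these.\<close>

lemma monodromy_group_eq:
  assumes full: "\<And>y. y \<in> fibre p x \<Longrightarrow> link_class y = fibre p x" and x: "x \<notin> critical_values p"
  shows "monodromy_group p x = BijGroup (fibre p x)"
proof -
  have "attained x \<sigma>" if "\<sigma> permutes fibre p x" for \<sigma>
    using that finite_fibre
  proof (induction rule: permutes_induct)
    case id
    then show ?case using attained_id[OF x] by (simp only: id_def)
  next
    case (swap a b \<sigma>)
    have "b \<in> link_class a" using full[OF swap.hyps(1)] swap.hyps(2) by simp
    then have "linked a b" by (simp add: link_class_def)
    then have "attained x (Transposition.transpose a b)"
      using swap.hyps by (auto simp: linked_def fibre_def)
    then show ?case using swap.IH swap.hyps(4) by (intro attained_compose) (auto simp: permutes_image)
  qed
  note permutation = this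
  have "\<exists>\<gamma>. base_loop p x \<gamma> \<and> induced_by p x \<gamma> \<sigma>" if \<sigma>: "\<sigma> \<in> Bij (fibre p x)" for \<sigma>
  proof -
    \<comment> \<open>Members of \<open>Bij\<close> are \<open>undefined\<close> outside the fibre,
      whereas \<open>permutes\<close> asks for the identity there; \<open>induced_by\<close> sees
      only the fibre and cannot distinguish the two.\<close>
    define \<tau> where "\<tau> = (\<lambda>y. if y \<in> fibre p x then \<sigma> y else y)"
    have "bij_betw \<tau> (fibre p x) (fibre p x) = bij_betw \<sigma> (fibre p x) (fibre p x)"
      by (rule bij_betw_cong) (simp add: \<tau>_def)
    then have "\<tau> permutes fibre p x"
      using \<sigma> by (intro bij_imp_permutes) (simp_all add: Bij_def \<tau>_def)
    then obtain \<gamma> where "base_loop p x \<gamma>" "induced_by p x \<gamma> \<tau>"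
      using permutation unfolding attained_def by blast
    moreover have "induced_by p x \<gamma> \<tau> = induced_by p x \<gamma> \<sigma>"
      unfolding induced_by_def by (rule ball_cong) (simp_all add: \<tau>_def)
    ultimately show ?thesis by blast
  qed
  then have "{\<sigma> \<in> Bij (fibre p x). \<exists>\<gamma>. base_loop p x \<gamma> \<and> induced_by p x \<gamma> \<sigma>} = Bij (fibre p x)"
    by blast
  then show ?thesis by (simp add: monodromy_group_def BijGroup_def)
qed

end

theorem theorem3p1:
  fixes m :: nat and a :: "nat \<Rightarrow> complex"
  assumes "m \<ge> 2"
    and "CVD m a \<noteq> 0"
  shows "(\<forall>y \<in> critical_points (monic_poly m a). nondegenerate (monic_poly m a) y)
       \<and> inj_on (poly (monic_poly m a)) (critical_points (monic_poly m a))
       \<and> (\<forall>x0 \<in> - critical_values (monic_poly m a).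
            card (fibre (monic_poly m a) x0) = m \<and>
            monodromy_group (monic_poly m a) x0 = BijGroup (fibre (monic_poly m a) x0))"
proof -
  let ?p = "monic_poly m a"
  note nondeg = CVD_nonzero_imp(1)[OF assms] and inj = CVD_nonzero_imp(2)[OF assms]
  interpret nonconst_poly ?p
    by unfold_locales (use assms(1) in \<open>simp add: degree_monic_poly\<close>)
  have monic: "lead_coeff ?p = 1" by (simp add: degree_monic_poly coeff_monic_poly)
  \<comment> \<open>Here \<open>m \<ge> 2\<close> guarantees a critical point, and with it a linked
    pair.\<close>
  have "degree (pderiv ?p) \<noteq> 0" using assms(1) by (simp add: degree_pderiv degree_monic_poly)
  then obtain c where c: "c \<in> critical_points ?p"
    using Fundamental_Theorem_Algebra.fundamental_theorem_of_algebra[of "pderiv ?p"]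
    by (auto simp: constant_degree critical_points_def)
  obtain y z where yz: "y \<in> regular_points" "y \<noteq> z" "linked y z"
    using ex_linked[OF c bspec[OF nondeg c] inj] by blast
  have "monodromy_group ?p x = BijGroup (fibre ?p x)" if x: "x \<notin> critical_values ?p" for x
  proof (rule monodromy_group_eq[OF _ x])
    fix w assume "w \<in> fibre ?p x"
    then have w: "poly ?p w = x" by (simp add: fibre_def)
    then have "w \<in> regular_points" using x by simp
    from link_class_eq_fibre[OF monic yz bspec[OF nondeg] inj this]
    show "link_class w = fibre ?p x" unfolding w .
  qed
  then show ?thesis using nondeg inj card_fibre by (simp add: degree_monic_poly)
qed

end
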